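(* Let $R$ be a unital ring and $(E,\omega)$ a row-finite weighted graph with at least one weighted vertex (i.e. $E^0_\omega\neq\emptyset$). Then the weighted Leavitt path algebra $L_R(E,\omega)$ is a simple ring if and only if $(E,\omega)$ is reducible and the Leavitt path algebra $L_R(F)$ is simple, where $F$ is the unweighted graph associated with $(E,\omega)$.
   Context: A weighted graph $(E,\omega)$, $E=(E^0,E^{\mathrm{st}},E^1,s,r,\omega)$, consists of countable sets $E^0$ (vertices), $E^{\mathrm{st}}$ (structured edges), $E^1$ (edges), maps $s,r:E^{\mathrm{st}}\to E^0$ and a weight map $\omega:E^{\mathrm{st}}\to\mathbb N=\{1,2,\dots\}$ such that $E^1=\bigsqcup_{\alpha\in E^{\mathrm{st}}}\{\alpha_1,\dots,\alpha_{\omega(\alpha)}\}$. It is row-finite if $s^{-1}(v)\subseteq E^{\mathrm{st}}$ is finite for every $v\in E^0$. A vertex $v$ is a sink if $s^{-1}(v)=\emptyset$; if $v$ is not a sink, $\omega(v):=\max\{\omega(\alpha)\mid\alpha\in s^{-1}(v)\}$. Let $(E^1)^*=\{\alpha_i^*\mid\alpha_i\in E^1\}$, $X=E^0\cup E^1\cup(E^1)^*$, and let $R\langle X\rangle$ be the free (non-unital) $R$-ring on $X$: the free left $R$-module on the nonempty words over $X$ with multiplication $(\sum r_xx)(\sum s_yy)=\sum r_xs_y\,xy$. The weighted Leavitt path algebra $L_R(E,\omega)$ is the quotient of $R\langle X\rangle$ by the ideal generated by the relations: (1) $vw=\delta_{vw}v$ for $v,w\in E^0$; (2) $s(\alpha)\alpha_i=\alpha_ir(\alpha)=\alpha_i$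 and $r(\alpha)\alpha_i^*=\alpha_i^*s(\alpha)=\alpha_i^*$ for $\alpha\in E^{\mathrm{st}}$, $1\le i\le\omega(\alpha)$; (3) $\sum_{\alpha\in s^{-1}(v)}\alpha_i\alpha_j^*=\delta_{ij}v$ for every non-sink $v$ and $1\le i,j\le\omega(v)$; (4) $\sum_{1\le i\le\max\{\omega(\alpha),\omega(\beta)\}}\alpha_i^*\beta_i=\delta_{\alpha\beta}r(\alpha)$ for all $\alpha,\beta\in E^{\mathrm{st}}$; where in (3) and (4) $\alpha_i:=\alpha_i^*:=0$ whenever $i>\omega(\alpha)$. A weighted graph with $\omega\equiv1$ is called unweighted; for an unweighted graph $F$ one identifies $F^{\mathrm{st}}$ and $F^1$ and writes $L_R(F)$ for its weighted Leavitt path algebra; this is the usual Leavitt path algebra. A path is either a single vertex or a word $x_1\cdots x_n$ ($n\ge1$) with $x_i\in E^1$ and $r(x_i)=s(x_{i+1})$, where $s(\alpha_i)=s(\alpha)$, $r(\alpha_i)=r(\alpha)$. For $u\in E^0$, $T(u)$ is the set of vertices $v$ such that there is a path from $u$ to $v$ (so $u\in T(u)$). A vertex $v$ is weighted if it is not a sink and $\omega(v)>1$; $E^0_\omega$ is the set of weighted vertices, and the weight forest is $\overline{E^0_\omega}=\bigcup_{v\in E^0_\omega}T(v)$. A weighted graph with $E^0_\omega\ne\emptyset$ is reducible if $|s^{-1}(v)|\le1$ and $|r^{-1}(v)\cap s^{-1}(\overline{E^0_\omega})|\le1$ for every $v\in\overline{E^0_\omega}$, and irreducible otherwise. The unweighted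 graph $F$ associated with $(E,\omega)$: $F^0=E^0$, $F^1=\{e_{\alpha_i}\mid\alpha_i\in E^1\}$, with $s(e_{\alpha_i})=s(\alpha)$, $r(e_{\alpha_i})=r(\alpha)$ if $s(\alpha)\notin\overline{E^0_\omega}$, and $s(e_{\alpha_i})=r(\alpha)$, $r(e_{\alpha_i})=s(\alpha)$ if $s(\alpha)\in\overline{E^0_\omega}$. A ring (here with local units) is simple if it is nonzero and its only two-sided ideals are $\{0\}$ and itself. *)

theory Defs
  imports
    "HOL-Library.Countable_Set"
    "HOL-Library.Poly_Mapping"
    "HOL-Algebra.QuotRing"
    "Graph_Theory.Arc_Walk"
begin

section \<open>Two-sided ideals and simplicity for rings without a unit\<close>

text \<open>
  The library predicate \<open>ideal\<close> demands a unital ring, but the algebras below have a unit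
  only if there are finitely many vertices. The definitions here never refer to the
  \<open>one\<close> field of the record.
\<close>

definition two_sided_ideal :: "'a set \<Rightarrow> ('a, 'm) ring_scheme \<Rightarrow> bool" where
  "two_sided_ideal I A \<longleftrightarrow>
     additive_subgroup I A \<and>
     (\<forall>a\<in>I. \<forall>x\<in>carrier A. x \<otimes>\<^bsub>A\<^esub> a \<in> I \<and> a \<otimes>\<^bsub>A\<^esub> x \<in> I)"

definition simple_rng :: "('a, 'm) ring_scheme \<Rightarrow> bool" where
  "simple_rng A \<longleftrightarrow>
     carrier A \<noteq> {\<zero>\<^bsub>A\<^esub>} \<and>
     (\<forall>I. two_sided_ideal I A \<longrightarrow> I = {\<zero>\<^bsub>A\<^esub>} \<or> I = carrier A)"


section \<open>The free non-unital ring on a set of letters\<close>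

text \<open>
  Words form a monoid under concatenation. It is written additively because the product on
  \<open>'k \<Rightarrow>\<^sub>0 'r\<close> is convolution over an additive monoid \<open>'k\<close>; on finitely supported functions
  on words it is the concatenation product.
\<close>

instantiation list :: (type) monoid_add
begin

definition zero_list_def: "0 = []"
definition plus_list_def: "xs + ys = xs @ ys"

instance
  by standard (simp_all add: zero_list_def plus_list_def)

end

text \<open>
  The sort \<open>{ring, monoid_mult}\<close> is that of arbitrary unital rings; unlike \<open>ring_1\<close> it does
  not exclude the zero ring. The \<open>one\<close> field below is a placeholder without meaning.
\<close>

definition free_rng :: "'x set \<Rightarrow> ('x list \<Rightarrow>\<^sub>0 'r::{ring, monoid_mult}) ring" where
  "free_rng X =
     \<lparr>carrier = {f. Poly_Mapping.keys f \<subseteq> lists X - {[]}},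
      mult = (*), one = 0, zero = 0, add = (+)\<rparr>"

text \<open>
  The ideal generated by a set, in the sense of rings over the coefficient ring: it is also
  closed under left multiplication by scalars (\<open>Poly_Mapping.single [] r\<close> is the scalar \<open>r\<close>,
  which does not itself belong to \<open>free_rng X\<close>).
\<close>

definition gen_ideal ::
    "'x set \<Rightarrow> ('x list \<Rightarrow>\<^sub>0 'r::{ring, monoid_mult}) set \<Rightarrow> ('x list \<Rightarrow>\<^sub>0 'r) set" where
  "gen_ideal X S =
     \<Inter>{I. two_sided_ideal I (free_rng X) \<and>
          (\<forall>r. \<forall>f\<in>I. Poly_Mapping.single [] r * f \<in> I) \<and> S \<subseteq> I}"


section \<open>Weighted graphs\<close>

text \<open>
  The digraph \<open>E\<close> consists of the vertices and the structured edges; source and range are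
  \<open>tail E\<close> and \<open>head E\<close>.
\<close>

locale weighted_graph = wf_digraph E
  for E :: "('v, 'e) pre_digraph" +
  fixes \<omega> :: "'e \<Rightarrow> nat"
  assumes countable_verts: "countable (verts E)"
    and countable_arcs: "countable (arcs E)"
    and weight_pos: "\<alpha> \<in> arcs E \<Longrightarrow> 1 \<le> \<omega> \<alpha>"

definition row_finite :: "('v, 'e) pre_digraph \<Rightarrow> bool" where
  "row_finite E \<longleftrightarrow> (\<forall>v\<in>verts E. finite (out_arcs E v))"

text \<open>The edge \<open>\<alpha>\<^sub>i\<close> is the pair \<open>(\<alpha>, i)\<close>.\<close>

definition edges :: "('v, 'e) pre_digraph \<Rightarrow> ('e \<Rightarrow> nat) \<Rightarrow> ('e \<times> nat) set" where
  "edges E \<omega> = (SIGMA \<alpha>:arcs E. {1..\<omega> \<alpha>})"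

definition edge_graph :: "('v, 'e) pre_digraph \<Rightarrow> ('e \<Rightarrow> nat) \<Rightarrow> ('v, 'e \<times> nat) pre_digraph" where
  "edge_graph E \<omega> =
     \<lparr>verts = verts E, arcs = edges E \<omega>,
      tail = (\<lambda>(\<alpha>, i). tail E \<alpha>), head = (\<lambda>(\<alpha>, i). head E \<alpha>)\<rparr>"

text \<open>Meaningful for non-sinks with finitely many outgoing structured edges only.\<close>

definition vertex_weight :: "('v, 'e) pre_digraph \<Rightarrow> ('e \<Rightarrow> nat) \<Rightarrow> 'v \<Rightarrow> nat" where
  "vertex_weight E \<omega> v = Max (\<omega> ` out_arcs E v)"

definition weighted_vertices :: "('v, 'e) pre_digraph \<Rightarrow> ('e \<Rightarrow> nat) \<Rightarrow> 'v set" where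
  "weighted_vertices E \<omega> = {v \<in> verts E. out_arcs E v \<noteq> {} \<and> vertex_weight E \<omega> v > 1}"

text \<open>The empty walk at a vertex is the path consisting of that vertex.\<close>

definition tree :: "('v, 'e) pre_digraph \<Rightarrow> ('e \<Rightarrow> nat) \<Rightarrow> 'v \<Rightarrow> 'v set" where
  "tree E \<omega> u = {v. \<exists>p. pre_digraph.awalk (edge_graph E \<omega>) u p v}"

definition weight_forest :: "('v, 'e) pre_digraph \<Rightarrow> ('e \<Rightarrow> nat) \<Rightarrow> 'v set" where
  "weight_forest E \<omega> = (\<Union>v\<in>weighted_vertices E \<omega>. tree E \<omega> v)"

text \<open>
  Finiteness is explicit since \<open>card\<close> is \<open>0\<close> on infinite sets, and a vertex of a row-finite
  graph may receive infinitely many edges.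
\<close>

definition reducible :: "('v, 'e) pre_digraph \<Rightarrow> ('e \<Rightarrow> nat) \<Rightarrow> bool" where
  "reducible E \<omega> \<longleftrightarrow>
     (\<forall>v\<in>weight_forest E \<omega>.
        (finite (out_arcs E v) \<and> card (out_arcs E v) \<le> 1) \<and>
        (let B = in_arcs E v \<inter> {\<alpha> \<in> arcs E. tail E \<alpha> \<in> weight_forest E \<omega>}
         in finite B \<and> card B \<le> 1))"

definition associated_graph ::
    "('v, 'e) pre_digraph \<Rightarrow> ('e \<Rightarrow> nat) \<Rightarrow> ('v, 'e \<times> nat) pre_digraph" where
  "associated_graph E \<omega> =
     \<lparr>verts = verts E, arcs = edges E \<omega>,
      tail = (\<lambda>(\<alpha>, i). if tail E \<alpha> \<in> weight_forest E \<omega> then head E \<alpha> else tail E \<alpha>),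
      head = (\<lambda>(\<alpha>, i). if tail E \<alpha> \<in> weight_forest E \<omega> then tail E \<alpha> else head E \<alpha>)\<rparr>"


section \<open>Weighted Leavitt path algebras\<close>

datatype ('v, 'e) letter = Vertex 'v | Edge "'e \<times> nat" | Ghost "'e \<times> nat"

definition letters :: "('v, 'e) pre_digraph \<Rightarrow> ('e \<Rightarrow> nat) \<Rightarrow> ('v, 'e) letter set" where
  "letters E \<omega> = Vertex ` verts E \<union> Edge ` edges E \<omega> \<union> Ghost ` edges E \<omega>"

definition vx :: "'v \<Rightarrow> ('v, 'e) letter list \<Rightarrow>\<^sub>0 'r::{ring, monoid_mult}" where
  "vx v = Poly_Mapping.single [Vertex v] 1"

definition ed :: "('e \<Rightarrow> nat) \<Rightarrow> 'e \<Rightarrow> nat \<Rightarrow> ('v, 'e) letter list \<Rightarrow>\<^sub>0 'r::{ring, monoid_mult}" where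
  "ed \<omega> \<alpha> i = (if i \<le> \<omega> \<alpha> then Poly_Mapping.single [Edge (\<alpha>, i)] 1 else 0)"

definition gh :: "('e \<Rightarrow> nat) \<Rightarrow> 'e \<Rightarrow> nat \<Rightarrow> ('v, 'e) letter list \<Rightarrow>\<^sub>0 'r::{ring, monoid_mult}" where
  "gh \<omega> \<alpha> i = (if i \<le> \<omega> \<alpha> then Poly_Mapping.single [Ghost (\<alpha>, i)] 1 else 0)"

text \<open>
  A relation \<open>x = y\<close> is encoded as the element \<open>x - y\<close>. The sums over \<open>out_arcs E v\<close> have
  their intended meaning for row-finite graphs.
\<close>

definition lpa_relations ::
    "('v, 'e) pre_digraph \<Rightarrow> ('e \<Rightarrow> nat) \<Rightarrow>
     (('v, 'e) letter list \<Rightarrow>\<^sub>0 'r::{ring, monoid_mult}) set" where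
  "lpa_relations E \<omega> =
     {vx v * vx w - (if v = w then vx v else 0) | v w. v \<in> verts E \<and> w \<in> verts E} \<union>
     {vx (tail E \<alpha>) * ed \<omega> \<alpha> i - ed \<omega> \<alpha> i | \<alpha> i. \<alpha> \<in> arcs E \<and> i \<in> {1..\<omega> \<alpha>}} \<union>
     {ed \<omega> \<alpha> i * vx (head E \<alpha>) - ed \<omega> \<alpha> i | \<alpha> i. \<alpha> \<in> arcs E \<and> i \<in> {1..\<omega> \<alpha>}} \<union>
     {vx (head E \<alpha>) * gh \<omega> \<alpha> i - gh \<omega> \<alpha> i | \<alpha> i. \<alpha> \<in> arcs E \<and> i \<in> {1..\<omega> \<alpha>}} \<union>
     {gh \<omega> \<alpha> i * vx (tail E \<alpha>) - gh \<omega> \<alpha> i | \<alpha> i. \<alpha> \<in> arcs E \<and> i \<in> {1..\<omega> \<alpha>}} \<union>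
     {(\<Sum>\<alpha>\<in>out_arcs E v. ed \<omega> \<alpha> i * gh \<omega> \<alpha> j) - (if i = j then vx v else 0) | v i j.
        v \<in> verts E \<and> out_arcs E v \<noteq> {} \<and>
        i \<in> {1..vertex_weight E \<omega> v} \<and> j \<in> {1..vertex_weight E \<omega> v}} \<union>
     {(\<Sum>i = 1..max (\<omega> \<alpha>) (\<omega> \<beta>). gh \<omega> \<alpha> i * ed \<omega> \<beta> i) -
        (if \<alpha> = \<beta> then vx (head E \<alpha>) else 0) | \<alpha> \<beta>. \<alpha> \<in> arcs E \<and> \<beta> \<in> arcs E}"

text \<open>The first argument only fixes the coefficient ring.\<close>

definition weighted_lpa ::
    "'r::{ring, monoid_mult} itself \<Rightarrow> ('v, 'e) pre_digraph \<Rightarrow> ('e \<Rightarrow> nat) \<Rightarrow>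
     (('v, 'e) letter list \<Rightarrow>\<^sub>0 'r) set ring" where
  "weighted_lpa _ E \<omega> =
     free_rng (letters E \<omega>) Quot gen_ideal (letters E \<omega>) (lpa_relations E \<omega>)"

definition lpa ::
    "'r::{ring, monoid_mult} itself \<Rightarrow> ('v, 'e) pre_digraph \<Rightarrow>
     (('v, 'e) letter list \<Rightarrow>\<^sub>0 'r) set ring" where
  "lpa R F = weighted_lpa R F (\<lambda>_. 1)"

end

theory Submission
  imports Defs
begin

text \<open>
  If the graph is reducible, exchanging \<open>\<alpha>\<^sub>i\<close> and \<open>\<alpha>\<^sub>i\<^sup>*\<close> over the weight forest turns the relations of
  \<open>L(E, \<omega>)\<close> into those of \<open>L(F)\<close>: there the relations (3) and (4) involve a single structured edge
  each, and reversing the edges exchanges them.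

  Conversely, suppose that the algebra is simple. It acts on functions on \<open>E\<^sup>0 \<times> \<nat>\<close> by partial
  injections, one family for each choice, at every non-sink \<open>v\<close>, of a bijection
  \<open>{v} \<times> \<nat> \<times> {1..\<omega>(v)} \<cong> \<Squnion>\<alpha>. {r(\<alpha>)} \<times> \<nat>\<close> that is compatible with the weights. All these representations
  are faithful, so a word that acts as zero in one of them acts as zero in all. Three configurations
  contradict this:
  \<^item> at a weighted vertex with two outgoing structured edges, an edge \<open>\<alpha>\<close> of maximal weight can
    leave row 1 to the other edges, so that \<open>\<alpha>\<^sub>1\<close> may or may not vanish;
  \<^item> if a path from a weighted vertex ends in \<open>\<delta>\<close> at an unweighted vertex that emits two edges, then
    the range of the path is infinite and coinfinite, as is the domain of an edge \<open>\<beta>\<close> emitted there;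
    a permutation inserted at \<open>\<delta>\<close> makes the path followed by \<open>\<beta>\<^sub>1\<close> vanish or not;
  \<^item> if paths from weighted vertices arrive at a vertex through different edges, the same argument
    applies to one path followed by the adjoint of the other.
\<close>


section \<open>Ideals of the free ring and of its quotients\<close>

definition nonempty_support :: "'x set \<Rightarrow> ('x list \<Rightarrow>\<^sub>0 'r::{ring, monoid_mult}) set" where
  "nonempty_support X = {f. Poly_Mapping.keys f \<subseteq> lists X - {[]}}"

lemma free_rng_simps [simp]:
  "carrier (free_rng X) = nonempty_support X"
  "f \<otimes>\<^bsub>free_rng X\<^esub> g = f * g"
  "f \<oplus>\<^bsub>free_rng X\<^esub> g = f + g"
  "\<zero>\<^bsub>free_rng X\<^esub> = 0"
  by (simp_all add: free_rng_def nonempty_support_def)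

lemma support_zero [simp]: "0 \<in> nonempty_support X"
  by (simp add: nonempty_support_def)

lemma support_uminus_iff [simp]: "- f \<in> nonempty_support X \<longleftrightarrow> f \<in> nonempty_support X"
  by (simp add: nonempty_support_def keys_def)

lemma support_add: "f \<in> nonempty_support X \<Longrightarrow> g \<in> nonempty_support X \<Longrightarrow> f + g \<in> nonempty_support X"
  using Poly_Mapping.keys_add[of f g] by (fastforce simp: nonempty_support_def)

lemma support_diff: "f \<in> nonempty_support X \<Longrightarrow> g \<in> nonempty_support X \<Longrightarrow> f - g \<in> nonempty_support X"
  using support_add[of f X "- g"] by simp

lemma support_mult:
  assumes "f \<in> nonempty_support X" "g \<in> nonempty_support X"
  shows "f * g \<in> nonempty_support X"
  using assms Poly_Mapping.keys_mult[of f g]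
  by (fastforce simp: nonempty_support_def plus_list_def)

lemma support_sum:
  assumes "\<And>i. i \<in> A \<Longrightarrow> f i \<in> nonempty_support X"
  shows "sum f A \<in> nonempty_support X"
  using assms by (induction A rule: infinite_finite_induct) (auto intro: support_add)

lemma support_single: "w \<in> lists X \<Longrightarrow> w \<noteq> [] \<Longrightarrow> Poly_Mapping.single w r \<in> nonempty_support X"
  by (simp add: nonempty_support_def)

lemma support_scalar:
  assumes "f \<in> nonempty_support X"
  shows "Poly_Mapping.single [] r * f \<in> nonempty_support X"
  using assms Poly_Mapping.keys_mult[of "Poly_Mapping.single [] r" f]
  by (fastforce simp: nonempty_support_def plus_list_def split: if_splits)

lemma abelian_group_free_rng: "abelian_group (free_rng X)"
proof (rule abelian_groupI)
  fix f :: "'a list \<Rightarrow>\<^sub>0 'r::{ring, monoid_mult}"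
  assume "f \<in> carrier (free_rng X)"
  then show "\<exists>g\<in>carrier (free_rng X). g \<oplus>\<^bsub>free_rng X\<^esub> f = \<zero>\<^bsub>free_rng X\<^esub>"
    by (intro bexI[of _ "- f"]) auto
qed (auto simp: support_add algebra_simps)

lemma a_inv_free_rng:
  assumes "f \<in> nonempty_support X" shows "\<ominus>\<^bsub>free_rng X\<^esub> f = - f"
proof -
  interpret abelian_group "free_rng X" by (rule abelian_group_free_rng)
  show ?thesis using assms by (intro minus_equality) auto
qed

lemma two_sided_ideal_free_rng:
  fixes I :: "('x list \<Rightarrow>\<^sub>0 'r::{ring, monoid_mult}) set"
  shows "two_sided_ideal I (free_rng X) \<longleftrightarrow>
    I \<subseteq> nonempty_support X \<and> 0 \<in> I \<and> (\<forall>f\<in>I. \<forall>g\<in>I. f + g \<in> I) \<and> (\<forall>f\<in>I. - f \<in> I) \<and>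
    (\<forall>f\<in>I. \<forall>g\<in>nonempty_support X. g * f \<in> I \<and> f * g \<in> I)" (is "_ \<longleftrightarrow> ?R")
proof -
  interpret A: abelian_group "free_rng X :: ('x list \<Rightarrow>\<^sub>0 'r) ring" by (rule abelian_group_free_rng)
  have inv: "inv\<^bsub>add_monoid (free_rng X)\<^esub> f = - f" if "f \<in> nonempty_support X" for f :: "'x list \<Rightarrow>\<^sub>0 'r"
    using a_inv_free_rng[OF that] by (simp add: a_inv_def)
  have "additive_subgroup I (free_rng X) \<longleftrightarrow>
      I \<subseteq> nonempty_support X \<and> 0 \<in> I \<and> (\<forall>f\<in>I. \<forall>g\<in>I. f + g \<in> I) \<and> (\<forall>f\<in>I. - f \<in> I)"
  proof (cases "I \<subseteq> nonempty_support X")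
    case True
    then have "(\<forall>f. f \<in> I \<longrightarrow> inv\<^bsub>add_monoid (free_rng X)\<^esub> f \<in> I) \<longleftrightarrow> (\<forall>f\<in>I. - f \<in> I)"
      using inv by (metis subsetD)
    then show ?thesis by (simp add: additive_subgroup_def subgroup_def) blast
  qed (simp add: additive_subgroup_def subgroup_def)
  then show ?thesis by (auto simp: two_sided_ideal_def)
qed

section \<open>Cosets of an ideal of the free ring and the ideals of the quotient\<close>

locale free_rng_ideal =
  fixes X :: "'x set" and I :: "('x list \<Rightarrow>\<^sub>0 'r::{ring, monoid_mult}) set"
  assumes two_sided: "two_sided_ideal I (free_rng X)"
begin

lemma subset: "f \<in> I \<Longrightarrow> f \<in> nonempty_support X"
  and zero: "0 \<in> I"
  and add: "f \<in> I \<Longrightarrow> g \<in> I \<Longrightarrow> f + g \<in> I"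
  and uminus: "f \<in> I \<Longrightarrow> - f \<in> I"
  and mult_left: "f \<in> I \<Longrightarrow> g \<in> nonempty_support X \<Longrightarrow> g * f \<in> I"
  and mult_right: "f \<in> I \<Longrightarrow> g \<in> nonempty_support X \<Longrightarrow> f * g \<in> I"
  using two_sided by (auto simp: two_sided_ideal_free_rng)

lemma diff: "f \<in> I \<Longrightarrow> g \<in> I \<Longrightarrow> f - g \<in> I"
  using add[of f "- g"] uminus by simp

lemma sum: "(\<And>i. i \<in> A \<Longrightarrow> f i \<in> I) \<Longrightarrow> Groups_Big.sum f A \<in> I"
  by (induction A rule: infinite_finite_induct) (auto intro: add zero)

lemma congruent: "f - g \<in> I \<Longrightarrow> g \<in> I \<Longrightarrow> f \<in> I"
  using add[of "f - g" g] by simp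

sublocale abelian_subgroup I "free_rng X"
  using two_sided abelian_group_free_rng abelian_group_def abelian_group_axioms_def
  by (auto intro!: abelian_subgroupI3 simp: two_sided_ideal_def)

lemma coset: "I +>\<^bsub>free_rng X\<^esub> f = {i + f | i. i \<in> I}"
  by (auto simp: a_r_coset_def r_coset_def)

lemma coset_eq_iff:
  assumes "f \<in> nonempty_support X" "g \<in> nonempty_support X"
  shows "I +>\<^bsub>free_rng X\<^esub> f = I +>\<^bsub>free_rng X\<^esub> g \<longleftrightarrow> f - g \<in> I"
proof
  assume "I +>\<^bsub>free_rng X\<^esub> f = I +>\<^bsub>free_rng X\<^esub> g"
  moreover have "f \<in> I +>\<^bsub>free_rng X\<^esub> f" using zero by (force simp: coset)
  ultimately obtain i where "i \<in> I" "f = i + g" by (auto simp: coset)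
  then show "f - g \<in> I" by simp
next
  assume h: "f - g \<in> I"
  have "i + f \<in> {i + g | i. i \<in> I}" if "i \<in> I" for i
    using add[OF that h] by (auto simp: algebra_simps intro!: exI[of _ "i + (f - g)"])
  moreover have "i + g \<in> {i + f | i. i \<in> I}" if "i \<in> I" for i
    using diff[OF that h] by (auto simp: algebra_simps intro!: exI[of _ "i - (f - g)"])
  ultimately show "I +>\<^bsub>free_rng X\<^esub> f = I +>\<^bsub>free_rng X\<^esub> g"
    by (auto simp: coset)
qed

text \<open>\<open>rcoset_mult\<close> is a union over all pairs of representatives. It collapses to
  one coset because other representatives change the product only by an element of
  \<open>I\<close>.\<close>

lemma coset_mult:
  assumes "f \<in> nonempty_support X" "g \<in> nonempty_support X"
  shows "rcoset_mult (free_rng X) I (I +>\<^bsub>free_rng X\<^esub> f) (I +>\<^bsub>free_rng X\<^esub> g) =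
    I +>\<^bsub>free_rng X\<^esub> (f * g)"
proof -
  have "I +>\<^bsub>free_rng X\<^esub> (a * b) = I +>\<^bsub>free_rng X\<^esub> (f * g)"
    if ab: "a \<in> I +>\<^bsub>free_rng X\<^esub> f" "b \<in> I +>\<^bsub>free_rng X\<^esub> g" for a b
  proof -
    obtain i j where ij: "i \<in> I" "j \<in> I" "a = i + f" "b = j + g" using ab by (auto simp: coset)
    then have car: "a \<in> nonempty_support X" "b \<in> nonempty_support X"
      using assms by (auto intro: support_add subset)
    have "a * b - f * g = i * b + f * j" using ij by (simp add: algebra_simps)
    also have "\<dots> \<in> I" using ij car assms by (intro add mult_left mult_right)
    finally show ?thesis using car assms by (subst coset_eq_iff) (auto intro: support_mult)
  qed
  then have "rcoset_mult (free_rng X) I (I +>\<^bsub>free_rng X\<^esub> f) (I +>\<^bsub>free_rng X\<^esub> g) =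
      (\<Union>a\<in>I +>\<^bsub>free_rng X\<^esub> f. \<Union>b\<in>I +>\<^bsub>free_rng X\<^esub> g. I +>\<^bsub>free_rng X\<^esub> (f * g))"
    unfolding rcoset_mult_def by (intro SUP_cong refl) simp
  moreover have "I +>\<^bsub>free_rng X\<^esub> f \<noteq> {}" "I +>\<^bsub>free_rng X\<^esub> g \<noteq> {}"
    using zero by (auto simp: coset)
  ultimately show ?thesis by simp
qed

lemma quotient_hom: "abelian_group_hom (free_rng X) (free_rng X Quot I) (\<lambda>f. I +>\<^bsub>free_rng X\<^esub> f)"
proof -
  have grp: "abelian_group (free_rng X Quot I)"
    by (rule comm_group_abelian_groupI)
      (simp add: FactRing_def a_factorgroup_is_comm_group[unfolded A_FactGroup_def'])
  have "(+>\<^bsub>free_rng X\<^esub>) I \<in> hom (add_monoid (free_rng X)) (add_monoid (free_rng X Quot I))"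
    by (intro homI) (auto simp: FactRing_def a_rcosetsI[OF a_subset] a_rcos_sum)
  then show ?thesis
    using grp abelian_group_free_rng
    by (intro abelian_group_homI group_hom.intro group_hom_axioms.intro abelian_group.a_group)
qed

lemma quotient_carrier:
  "carrier (free_rng X Quot I) = (\<lambda>f. I +>\<^bsub>free_rng X\<^esub> f) ` nonempty_support X"
  by (auto simp: FactRing_def A_RCOSETS_defs(1) RCOSETS_def a_r_coset_def)

text \<open>Correspondence theorem: image and preimage under the quotient map match the ideals of
  the quotient with the ideals of the free ring above \<open>I\<close>. Simplicity becomes
  maximality of \<open>I\<close>, and later arguments need not handle cosets.\<close>

lemma simple_quotient_iff:
  "simple_rng (free_rng X Quot I) \<longleftrightarrow>
     I \<noteq> nonempty_support X \<and>
     (\<forall>J. two_sided_ideal J (free_rng X) \<and> I \<subseteq> J \<longrightarrow> J = I \<or> J = nonempty_support X)"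
proof -
  let ?h = "\<lambda>f. I +>\<^bsub>free_rng X\<^esub> f"
  let ?Q = "free_rng X Quot I"
  let ?C = "nonempty_support X"
  interpret h: abelian_group_hom "free_rng X" ?Q ?h by (rule quotient_hom)
  have mult: "?h f \<otimes>\<^bsub>?Q\<^esub> ?h g = ?h (f * g)" if "f \<in> ?C" "g \<in> ?C" for f g
    using coset_mult[OF that] by (simp add: FactRing_def)
  have zero_Q: "\<zero>\<^bsub>?Q\<^esub> = I" by (simp add: FactRing_def)
  have h0: "?h f = I \<longleftrightarrow> f \<in> I" if "f \<in> ?C" for f
    using coset_eq_iff[OF that support_zero] by (simp add: coset)
  have image_ideal: "two_sided_ideal (?h ` J) ?Q" if J: "two_sided_ideal J (free_rng X)" for J
  proof -
    interpret J: free_rng_ideal X J using J by unfold_locales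
    have "subgroup (?h ` J) (add_monoid ?Q)"
    proof
      show "?h ` J \<subseteq> carrier (add_monoid ?Q)" using J.subset by auto
      show "\<one>\<^bsub>add_monoid ?Q\<^esub> \<in> ?h ` J"
        using h.hom_zero J.zero by (force simp del: h.hom_zero)
      show "x \<otimes>\<^bsub>add_monoid ?Q\<^esub> y \<in> ?h ` J" if "x \<in> ?h ` J" "y \<in> ?h ` J" for x y
      proof -
        from that obtain f g where fg: "f \<in> J" "g \<in> J" "x = ?h f" "y = ?h g" by auto
        then have "x \<otimes>\<^bsub>add_monoid ?Q\<^esub> y = ?h (f + g)"
          using h.hom_add[of f g] J.subset by simp
        then show ?thesis using fg J.add by auto
      qed
      show "inv\<^bsub>add_monoid ?Q\<^esub> x \<in> ?h ` J" if x: "x \<in> ?h ` J" for x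
      proof -
        from x obtain f where f: "f \<in> J" "x = ?h f" by auto
        then have "inv\<^bsub>add_monoid ?Q\<^esub> x = ?h (- f)"
          using h.hom_a_inv[of f] J.subset a_inv_free_rng[of f X] by (simp add: a_inv_def)
        then show ?thesis using f J.uminus by auto
      qed
    qed
    moreover have "x \<otimes>\<^bsub>?Q\<^esub> a \<in> ?h ` J \<and> a \<otimes>\<^bsub>?Q\<^esub> x \<in> ?h ` J" if "a \<in> ?h ` J" "x \<in> carrier ?Q" for a x
    proof -
      from that obtain f g where "f \<in> J" "a = ?h f" "g \<in> ?C" "x = ?h g" by (auto simp: quotient_carrier)
      then show ?thesis using J.subset J.mult_left J.mult_right by (auto simp: mult)
    qed
    ultimately show ?thesis by (auto simp: two_sided_ideal_def additive_subgroup_def)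
  qed
  have preimage_ideal: "two_sided_ideal {f \<in> ?C. ?h f \<in> K} (free_rng X)" if K: "two_sided_ideal K ?Q" for K
  proof -
    interpret K: additive_subgroup K ?Q using K by (simp add: two_sided_ideal_def)
    have "?h (f + g) \<in> K" if "f \<in> ?C" "g \<in> ?C" "?h f \<in> K" "?h g \<in> K" for f g
      using h.hom_add[of f g] that K.a_closed[of "?h f" "?h g"] by simp
    moreover have "?h (- f) \<in> K" if "f \<in> ?C" "?h f \<in> K" for f
      using h.hom_a_inv[of f] that K.a_inv_closed[of "?h f"] h.H.abelian_group_axioms
      by (simp add: a_inv_free_rng)
    moreover have "?h 0 \<in> K" using h.hom_zero K.zero_closed by simp
    moreover have "?h (g * f) \<in> K \<and> ?h (f * g) \<in> K" if "f \<in> ?C" "g \<in> ?C" "?h f \<in> K" for f g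
    proof -
      have "?h g \<in> carrier ?Q" using that by (auto simp: quotient_carrier)
      then have "?h g \<otimes>\<^bsub>?Q\<^esub> ?h f \<in> K \<and> ?h f \<otimes>\<^bsub>?Q\<^esub> ?h g \<in> K"
        using K that by (simp add: two_sided_ideal_def)
      then show ?thesis using that by (simp add: mult)
    qed
    ultimately show ?thesis
      unfolding two_sided_ideal_free_rng by (auto intro: support_add support_mult)
  qed
  have whole: "carrier ?Q = {\<zero>\<^bsub>?Q\<^esub>} \<longleftrightarrow> I = ?C"
  proof
    assume "carrier ?Q = {\<zero>\<^bsub>?Q\<^esub>}"
    then have "?h f = I" if "f \<in> ?C" for f using that by (auto simp: quotient_carrier zero_Q)
    then show "I = ?C" using h0 subset by blast
  next
    assume "I = ?C"
    then have "?h f = I" if "f \<in> ?C" for f using that h0 by auto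
    then have "?h ` ?C = {I}" using support_zero by blast
    then show "carrier ?Q = {\<zero>\<^bsub>?Q\<^esub>}" by (simp add: quotient_carrier zero_Q)
  qed
  show ?thesis
  proof (intro iffI conjI allI impI)
    assume s: "simple_rng ?Q"
    then show "I \<noteq> ?C" using whole by (simp add: simple_rng_def)
    fix J assume J: "two_sided_ideal J (free_rng X) \<and> I \<subseteq> J"
    interpret J: free_rng_ideal X J using J by unfold_locales auto
    from s image_ideal J consider "?h ` J = {I}" | "?h ` J = carrier ?Q"
      unfolding simple_rng_def zero_Q by blast
    then show "J = I \<or> J = ?C"
    proof cases
      case 1
      then have "f \<in> I" if "f \<in> J" for f using h0[OF J.subset[OF that]] that by auto
      then have "J \<subseteq> I" by auto
      then show ?thesis using J by auto
    next
      case 2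
      have "f \<in> J" if f: "f \<in> ?C" for f
      proof -
        have "?h f \<in> ?h ` J" using 2 f by (auto simp: quotient_carrier)
        then obtain g where g: "g \<in> J" "?h f = ?h g" by auto
        then have "f - g \<in> J" using J coset_eq_iff[OF f J.subset[OF g(1)]] by auto
        then show ?thesis using g J.congruent by auto
      qed
      then show ?thesis using J.subset by auto
    qed
  next
    assume m: "I \<noteq> ?C \<and> (\<forall>J. two_sided_ideal J (free_rng X) \<and> I \<subseteq> J \<longrightarrow> J = I \<or> J = ?C)"
    show "simple_rng ?Q"
      unfolding simple_rng_def
    proof (intro conjI allI impI)
      show "carrier ?Q \<noteq> {\<zero>\<^bsub>?Q\<^esub>}" using whole m by auto
      fix K assume K: "two_sided_ideal K ?Q"
      interpret K: additive_subgroup K ?Q using K by (simp add: two_sided_ideal_def)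
      let ?J = "{f \<in> ?C. ?h f \<in> K}"
      have KC: "K \<subseteq> ?h ` ?C" using K.a_subset by (simp add: quotient_carrier)
      have "I \<in> K" using K.zero_closed by (simp add: zero_Q)
      then have "f \<in> ?J" if "f \<in> I" for f using h0[OF subset[OF that]] that subset by simp
      then have "I \<subseteq> ?J" by auto
      then consider "?J = I" | "?J = ?C" using preimage_ideal[OF K] m by blast
      then show "K = {\<zero>\<^bsub>?Q\<^esub>} \<or> K = carrier ?Q"
      proof cases
        case 1
        have "x = I" if "x \<in> K" for x
        proof -
          obtain f where f: "f \<in> ?C" "x = ?h f" using KC \<open>x \<in> K\<close> by auto
          then have "f \<in> ?J" using that by simp
          then have "f \<in> I" unfolding 1 .
          then show ?thesis using h0[OF f(1)] f(2) by simp
        qed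
        then have "K = {I}" using \<open>I \<in> K\<close> by blast
        then show ?thesis by (simp add: zero_Q)
      next
        case 2
        then have "?h ` ?C \<subseteq> K" by blast
        then show ?thesis using KC by (simp add: quotient_carrier subset_antisym)
      qed
    qed
  qed
qed

end

section \<open>Generated ideals\<close>

lemma gen_ideal_least:
  assumes "two_sided_ideal I (free_rng X)"
    and "\<And>r f. f \<in> I \<Longrightarrow> Poly_Mapping.single [] r * f \<in> I"
    and "S \<subseteq> I"
  shows "gen_ideal X S \<subseteq> I"
  using assms by (auto simp: gen_ideal_def)

lemma gen_ideal_superset: "S \<subseteq> gen_ideal X S"
  by (auto simp: gen_ideal_def)

lemma gen_ideal_scalar: "f \<in> gen_ideal X S \<Longrightarrow> Poly_Mapping.single [] r * f \<in> gen_ideal X S"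
  by (auto simp: gen_ideal_def)

text \<open>The assumption puts \<open>nonempty_support X\<close> into the family that is
  intersected; over an empty family the intersection would be the whole type.\<close>

lemma gen_ideal_two_sided:
  assumes "S \<subseteq> nonempty_support X"
  shows "two_sided_ideal (gen_ideal X S) (free_rng X)"
proof -
  have "two_sided_ideal (nonempty_support X) (free_rng X)"
    by (auto simp: two_sided_ideal_free_rng support_add support_mult)
  then have "gen_ideal X S \<subseteq> nonempty_support X"
    using assms by (intro gen_ideal_least) (auto intro: support_scalar)
  then show ?thesis
    by (auto simp: two_sided_ideal_free_rng gen_ideal_def)
qed


section \<open>Relabelling the letters\<close>

text \<open>Splits off one monomial at a time, so that additive statements need only be checked on
  monomials.\<close>

lemma poly_mapping_induct_single [case_names zero add single]:
  assumes "P 0" "\<And>f g. P f \<Longrightarrow> P g \<Longrightarrow> P (f + g)" "\<And>k r. P (Poly_Mapping.single k r)"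
  shows "P (f :: 'k \<Rightarrow>\<^sub>0 'r::comm_monoid_add)"
proof (induction f rule: Poly_Mapping.update_induct)
  case const
  then show ?case by (rule assms(1))
next
  case (update f k r)
  have "Poly_Mapping.update k r f = Poly_Mapping.single k r + f"
    using update by (intro poly_mapping_eqI)
      (auto simp: lookup_update lookup_add lookup_single when_def in_keys_iff)
  then show ?case using assms(2,3) update by simp
qed

lemma poly_mapping_sum_single:
  fixes f :: "'k \<Rightarrow>\<^sub>0 'r::comm_monoid_add"
  shows "f = (\<Sum>k\<in>Poly_Mapping.keys f. Poly_Mapping.single k (Poly_Mapping.lookup f k))"
  by (intro poly_mapping_eqI) (auto simp: lookup_sum lookup_single when_def in_keys_iff)

text \<open>The homomorphism induced by a map on letters. It is a sum over the support because
  \<open>\<psi>\<close> may identify words, whose coefficients must then be added.\<close>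

definition relabel :: "('x \<Rightarrow> 'y) \<Rightarrow> ('x list \<Rightarrow>\<^sub>0 'r::ring) \<Rightarrow> ('y list \<Rightarrow>\<^sub>0 'r)" where
  "relabel \<psi> f = (\<Sum>w\<in>Poly_Mapping.keys f. Poly_Mapping.single (map \<psi> w) (Poly_Mapping.lookup f w))"

text \<open>Lets the sums for several elements run over a common finite index set.\<close>

lemma relabel_superset:
  assumes "finite A" "Poly_Mapping.keys f \<subseteq> A"
  shows "relabel \<psi> f = (\<Sum>w\<in>A. Poly_Mapping.single (map \<psi> w) (Poly_Mapping.lookup f w))"
  unfolding relabel_def using assms
  by (intro sum.mono_neutral_left) (auto simp: in_keys_iff)

lemma relabel_single [simp]: "relabel \<psi> (Poly_Mapping.single w r) = Poly_Mapping.single (map \<psi> w) r"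
  by (subst relabel_superset[of "{w}"]) auto

lemma relabel_zero [simp]: "relabel \<psi> 0 = 0"
  by (simp add: relabel_def)

lemma relabel_add: "relabel \<psi> (f + g) = relabel \<psi> f + relabel \<psi> g"
proof -
  let ?A = "Poly_Mapping.keys f \<union> Poly_Mapping.keys g"
  have "relabel \<psi> (f + g) = (\<Sum>w\<in>?A. Poly_Mapping.single (map \<psi> w) (Poly_Mapping.lookup (f + g) w))"
    using Poly_Mapping.keys_add[of f g] by (intro relabel_superset) auto
  also have "\<dots> = relabel \<psi> f + relabel \<psi> g"
    by (simp add: relabel_superset[of ?A f] relabel_superset[of ?A g] lookup_add single_add sum.distrib)
  finally show ?thesis .
qed

lemma relabel_uminus: "relabel \<psi> (- f) = - relabel \<psi> f"
  using relabel_add[of \<psi> f "- f"] by (simp add: minus_unique)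

lemma relabel_diff: "relabel \<psi> (f - g) = relabel \<psi> f - relabel \<psi> g"
  using relabel_add[of \<psi> f "- g"] by (simp add: relabel_uminus)

lemma relabel_sum: "relabel \<psi> (sum f A) = (\<Sum>i\<in>A. relabel \<psi> (f i))"
  by (induction A rule: infinite_finite_induct) (auto simp: relabel_add)

lemma relabel_mult: "relabel \<psi> (f * g) = relabel \<psi> f * relabel \<psi> g"
proof (induction f rule: poly_mapping_induct_single)
  case (single v r)
  show ?case
    by (induction g rule: poly_mapping_induct_single)
      (auto simp: relabel_add distrib_left mult_single plus_list_def)
qed (auto simp: relabel_add distrib_right)

lemma relabel_relabel:
  assumes "\<And>x. x \<in> X \<Longrightarrow> \<theta> (\<psi> x) = x" "f \<in> nonempty_support X"
  shows "relabel \<theta> (relabel \<psi> f) = f"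
proof -
  have "map \<theta> (map \<psi> w) = w" if "w \<in> Poly_Mapping.keys f" for w
    using assms that by (auto simp: nonempty_support_def lists_eq_set subset_iff intro!: map_idI)
  then have "relabel \<theta> (relabel \<psi> f) =
      (\<Sum>w\<in>Poly_Mapping.keys f. Poly_Mapping.single w (Poly_Mapping.lookup f w))"
    unfolding relabel_def[of \<psi>] relabel_sum by (intro sum.cong) simp_all
  then show ?thesis by (simp flip: poly_mapping_sum_single)
qed

lemma relabel_support:
  assumes "\<psi> ` X \<subseteq> Y" "f \<in> nonempty_support X"
  shows "relabel \<psi> f \<in> nonempty_support Y"
  unfolding relabel_def using assms
  by (intro support_sum support_single) (auto simp: nonempty_support_def lists_eq_set image_subset_iff)

lemma relabel_preimage_ideal:
  assumes "two_sided_ideal J (free_rng Y)" "\<psi> ` X \<subseteq> Y"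
  shows "two_sided_ideal {f \<in> nonempty_support X. relabel \<psi> f \<in> J} (free_rng X)"
proof -
  interpret J: free_rng_ideal Y J using assms by unfold_locales
  show ?thesis
    by (auto simp: two_sided_ideal_free_rng relabel_add relabel_mult relabel_uminus
        J.zero J.add J.uminus support_add support_mult
        intro: J.mult_left J.mult_right relabel_support[OF assms(2)])
qed

text \<open>The preimage of \<open>gen_ideal Y T\<close> is an ideal that contains \<open>S\<close>.
  It is closed under scalars because relabelling fixes the empty word, so minimality of
  \<open>gen_ideal X S\<close> applies.\<close>

lemma relabel_gen_ideal:
  assumes "\<psi> ` X \<subseteq> Y" "S \<subseteq> nonempty_support X" "T \<subseteq> nonempty_support Y"
    and "relabel \<psi> ` S \<subseteq> gen_ideal Y T" "f \<in> gen_ideal X S"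
  shows "relabel \<psi> f \<in> gen_ideal Y T"
proof -
  have "gen_ideal X S \<subseteq> {f \<in> nonempty_support X. relabel \<psi> f \<in> gen_ideal Y T}"
    using assms
    by (intro gen_ideal_least relabel_preimage_ideal[of _ Y] gen_ideal_two_sided)
      (auto simp: relabel_mult intro: support_scalar gen_ideal_scalar)
  then show ?thesis using assms by auto
qed

text \<open>The relabellings induce mutually inverse isomorphisms of the quotients. Instead of
  building these, the proof pulls an ideal above \<open>gen_ideal Y T\<close> back along
  \<open>\<psi>\<close> and uses maximality over \<open>X\<close>.\<close>

lemma simple_quotient_relabel_imp:
  assumes maps: "\<psi> ` X \<subseteq> Y" "\<theta> ` Y \<subseteq> X"
    and inverse: "\<And>x. x \<in> X \<Longrightarrow> \<theta> (\<psi> x) = x" "\<And>y. y \<in> Y \<Longrightarrow> \<psi> (\<theta> y) = y"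
    and ST: "S \<subseteq> nonempty_support X" "T \<subseteq> nonempty_support Y"
    and rel: "relabel \<psi> ` S \<subseteq> gen_ideal Y T" "relabel \<theta> ` T \<subseteq> gen_ideal X S"
    and simple: "simple_rng (free_rng X Quot gen_ideal X S)"
  shows "simple_rng (free_rng Y Quot gen_ideal Y T)"
proof -
  interpret I: free_rng_ideal X "gen_ideal X S"
    by unfold_locales (rule gen_ideal_two_sided[OF ST(1)])
  interpret K: free_rng_ideal Y "gen_ideal Y T"
    by unfold_locales (rule gen_ideal_two_sided[OF ST(2)])
  note \<psi>I = relabel_gen_ideal[OF maps(1) ST rel(1)] and \<theta>I = relabel_gen_ideal[OF maps(2) ST(2,1) rel(2)]
  note \<theta>\<psi> = relabel_relabel[of X \<theta> \<psi>, OF inverse(1)] and \<psi>\<theta> = relabel_relabel[of Y \<psi> \<theta>, OF inverse(2)]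
  have max: "J = gen_ideal X S \<or> J = nonempty_support X"
    if "two_sided_ideal J (free_rng X)" "gen_ideal X S \<subseteq> J" for J
    using simple that unfolding I.simple_quotient_iff by blast
  show ?thesis unfolding K.simple_quotient_iff
  proof (intro conjI allI impI)
    show "gen_ideal Y T \<noteq> nonempty_support Y"
    proof
      assume "gen_ideal Y T = nonempty_support Y"
      then have "f \<in> gen_ideal X S" if "f \<in> nonempty_support X" for f
        using \<theta>I[of "relabel \<psi> f"] \<theta>\<psi>[OF _ that] relabel_support[OF maps(1) that] by simp
      then show False using simple I.subset unfolding I.simple_quotient_iff by blast
    qed
    fix J assume J: "two_sided_ideal J (free_rng Y) \<and> gen_ideal Y T \<subseteq> J"
    interpret J: free_rng_ideal Y J using J by unfold_locales auto
    let ?J = "{f \<in> nonempty_support X. relabel \<psi> f \<in> J}"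
    have "two_sided_ideal ?J (free_rng X)" using J maps by (intro relabel_preimage_ideal) auto
    moreover have "gen_ideal X S \<subseteq> ?J" using \<psi>I I.subset J by auto
    ultimately consider "?J = gen_ideal X S" | "?J = nonempty_support X" using max by blast
    then show "J = gen_ideal Y T \<or> J = nonempty_support Y"
    proof cases
      case 1
      have "g \<in> gen_ideal Y T" if g: "g \<in> J" for g
      proof -
        have "relabel \<theta> g \<in> ?J"
          using g J.subset[OF g] \<psi>\<theta>[of g] relabel_support[OF maps(2)] by simp
        then show ?thesis using 1 \<psi>I[of "relabel \<theta> g"] \<psi>\<theta>[of g] J.subset[OF g] by simp
      qed
      then show ?thesis using J by auto
    next
      case 2
      have "g \<in> J" if g: "g \<in> nonempty_support Y" for g
      proof -
        have "relabel \<theta> g \<in> ?J" using 2 g relabel_support[OF maps(2)] by auto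
        then show ?thesis using \<psi>\<theta>[of g] g by simp
      qed
      then show ?thesis using J.subset by auto
    qed
  qed
qed

lemma simple_quotient_relabel:
  assumes "\<psi> ` X \<subseteq> Y" "\<theta> ` Y \<subseteq> X"
    and "\<And>x. x \<in> X \<Longrightarrow> \<theta> (\<psi> x) = x" "\<And>y. y \<in> Y \<Longrightarrow> \<psi> (\<theta> y) = y"
    and "S \<subseteq> nonempty_support X" "T \<subseteq> nonempty_support Y"
    and "relabel \<psi> ` S \<subseteq> gen_ideal Y T" "relabel \<theta> ` T \<subseteq> gen_ideal X S"
  shows "simple_rng (free_rng X Quot gen_ideal X S) \<longleftrightarrow> simple_rng (free_rng Y Quot gen_ideal Y T)"
  using assms simple_quotient_relabel_imp[of \<psi> X Y \<theta> S T] simple_quotient_relabel_imp[of \<theta> Y X \<psi> T S]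
  by blast

section \<open>The relations of a weighted Leavitt path algebra\<close>

text \<open>Modulo \<open>I\<close>, the product equals \<open>a * p * q * b\<close>. In the
  applications \<open>p\<close> and \<open>q\<close> are the distinct vertices at which
  \<open>a\<close> ends and \<open>b\<close> starts.\<close>

lemma (in free_rng_ideal) orthogonal:
  assumes "a * p - a \<in> I" "q * b - b \<in> I" "p * q \<in> I"
    and "a \<in> nonempty_support X" "b \<in> nonempty_support X" "q \<in> nonempty_support X"
  shows "a * b \<in> I"
proof -
  have "a * b = a * (p * q) * b - (a * p - a) * (q * b) - a * (q * b - b)"
    by (simp add: algebra_simps)
  also have "\<dots> \<in> I"
    using assms
    by (intro diff[OF diff[OF mult_right[OF mult_left] mult_right] mult_left]) (auto intro: support_mult)
  finally show ?thesis .
qed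

lemma lpa_relationsI:
  shows "v \<in> verts E \<Longrightarrow> w \<in> verts E \<Longrightarrow>
      vx v * vx w - (if v = w then vx v else 0) \<in> lpa_relations E \<omega>"
    and "\<alpha> \<in> arcs E \<Longrightarrow> i \<in> {1..\<omega> \<alpha>} \<Longrightarrow>
      vx (tail E \<alpha>) * ed \<omega> \<alpha> i - ed \<omega> \<alpha> i \<in> lpa_relations E \<omega>"
    and "\<alpha> \<in> arcs E \<Longrightarrow> i \<in> {1..\<omega> \<alpha>} \<Longrightarrow>
      ed \<omega> \<alpha> i * vx (head E \<alpha>) - ed \<omega> \<alpha> i \<in> lpa_relations E \<omega>"
    and "\<alpha> \<in> arcs E \<Longrightarrow> i \<in> {1..\<omega> \<alpha>} \<Longrightarrow>
      vx (head E \<alpha>) * gh \<omega> \<alpha> i - gh \<omega> \<alpha> i \<in> lpa_relations E \<omega>"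
    and "\<alpha> \<in> arcs E \<Longrightarrow> i \<in> {1..\<omega> \<alpha>} \<Longrightarrow>
      gh \<omega> \<alpha> i * vx (tail E \<alpha>) - gh \<omega> \<alpha> i \<in> lpa_relations E \<omega>"
    and "v \<in> verts E \<Longrightarrow> out_arcs E v \<noteq> {} \<Longrightarrow>
      i \<in> {1..vertex_weight E \<omega> v} \<Longrightarrow> j \<in> {1..vertex_weight E \<omega> v} \<Longrightarrow>
      (\<Sum>\<alpha>\<in>out_arcs E v. ed \<omega> \<alpha> i * gh \<omega> \<alpha> j) - (if i = j then vx v else 0) \<in> lpa_relations E \<omega>"
    and "\<alpha> \<in> arcs E \<Longrightarrow> \<beta> \<in> arcs E \<Longrightarrow>
      (\<Sum>i = 1..max (\<omega> \<alpha>) (\<omega> \<beta>). gh \<omega> \<alpha> i * ed \<omega> \<beta> i) -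
        (if \<alpha> = \<beta> then vx (head E \<alpha>) else 0) \<in> lpa_relations E \<omega>"
  unfolding lpa_relations_def by blast+

text \<open>One case per family of relations. It is used with \<open>h\<close> a relabelling and
  with \<open>h\<close> the identity.\<close>

lemma image_lpa_relations_subset:
  assumes "\<And>v w. v \<in> verts E \<Longrightarrow> w \<in> verts E \<Longrightarrow> h (vx v * vx w - (if v = w then vx v else 0)) \<in> I"
    and "\<And>\<alpha> i. \<alpha> \<in> arcs E \<Longrightarrow> i \<in> {1..\<omega> \<alpha>} \<Longrightarrow> h (vx (tail E \<alpha>) * ed \<omega> \<alpha> i - ed \<omega> \<alpha> i) \<in> I"
    and "\<And>\<alpha> i. \<alpha> \<in> arcs E \<Longrightarrow> i \<in> {1..\<omega> \<alpha>} \<Longrightarrow> h (ed \<omega> \<alpha> i * vx (head E \<alpha>) - ed \<omega> \<alpha> i) \<in> I"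
    and "\<And>\<alpha> i. \<alpha> \<in> arcs E \<Longrightarrow> i \<in> {1..\<omega> \<alpha>} \<Longrightarrow> h (vx (head E \<alpha>) * gh \<omega> \<alpha> i - gh \<omega> \<alpha> i) \<in> I"
    and "\<And>\<alpha> i. \<alpha> \<in> arcs E \<Longrightarrow> i \<in> {1..\<omega> \<alpha>} \<Longrightarrow> h (gh \<omega> \<alpha> i * vx (tail E \<alpha>) - gh \<omega> \<alpha> i) \<in> I"
    and "\<And>v i j. v \<in> verts E \<Longrightarrow> out_arcs E v \<noteq> {} \<Longrightarrow> i \<in> {1..vertex_weight E \<omega> v} \<Longrightarrow>
      j \<in> {1..vertex_weight E \<omega> v} \<Longrightarrow>
      h ((\<Sum>\<alpha>\<in>out_arcs E v. ed \<omega> \<alpha> i * gh \<omega> \<alpha> j) - (if i = j then vx v else 0)) \<in> I"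
    and "\<And>\<alpha> \<beta>. \<alpha> \<in> arcs E \<Longrightarrow> \<beta> \<in> arcs E \<Longrightarrow>
      h ((\<Sum>i = 1..max (\<omega> \<alpha>) (\<omega> \<beta>). gh \<omega> \<alpha> i * ed \<omega> \<beta> i) -
        (if \<alpha> = \<beta> then vx (head E \<alpha>) else 0)) \<in> I"
  shows "h ` lpa_relations E \<omega> \<subseteq> I"
  unfolding lpa_relations_def using assms by (simp only: image_Un Un_subset_iff) blast

lemma vx_support: "v \<in> verts E \<Longrightarrow> vx v \<in> nonempty_support (letters E \<omega>)"
  unfolding vx_def by (rule support_single) (auto simp: letters_def)

lemma ed_support: "\<alpha> \<in> arcs E \<Longrightarrow> 1 \<le> i \<Longrightarrow> ed \<omega> \<alpha> i \<in> nonempty_support (letters E \<omega>)"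
  unfolding ed_def by (auto simp: letters_def edges_def intro!: support_single)

lemma gh_support: "\<alpha> \<in> arcs E \<Longrightarrow> 1 \<le> i \<Longrightarrow> gh \<omega> \<alpha> i \<in> nonempty_support (letters E \<omega>)"
  unfolding gh_def by (auto simp: letters_def edges_def intro!: support_single)

lemma (in wf_digraph) lpa_relations_support: "lpa_relations G \<omega> \<subseteq> nonempty_support (letters G \<omega>)"
  unfolding lpa_relations_def
  by (auto intro!: support_diff support_mult support_sum vx_support ed_support gh_support)

lemma weighted_lpa_eq:
  "weighted_lpa R E \<omega> = free_rng (letters E \<omega>) Quot gen_ideal (letters E \<omega>) (lpa_relations E \<omega>)"
  by (simp add: weighted_lpa_def)


section \<open>The weight forest\<close>

lemma edge_graph_simps [simp]:
  "verts (edge_graph E \<omega>) = verts E"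
  "arcs (edge_graph E \<omega>) = edges E \<omega>"
  "tail (edge_graph E \<omega>) a = tail E (fst a)"
  "head (edge_graph E \<omega>) a = head E (fst a)"
  by (simp_all add: edge_graph_def split: prod.split)

context weighted_graph
begin

lemma wf_edge_graph: "wf_digraph (edge_graph E \<omega>)"
  by unfold_locales (auto simp: edges_def)

lemma weighted_vertices_subset_forest: "weighted_vertices E \<omega> \<subseteq> weight_forest E \<omega>"
proof
  fix v assume v: "v \<in> weighted_vertices E \<omega>"
  interpret D: wf_digraph "edge_graph E \<omega>" by (rule wf_edge_graph)
  have "D.awalk v [] v" using v by (simp add: D.awalk_Nil_iff weighted_vertices_def)
  then show "v \<in> weight_forest E \<omega>" using v by (auto simp: weight_forest_def tree_def)
qed

lemma forest_closed:
  assumes "\<alpha> \<in> arcs E" "tail E \<alpha> \<in> weight_forest E \<omega>"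
  shows "head E \<alpha> \<in> weight_forest E \<omega>"
proof -
  interpret D: wf_digraph "edge_graph E \<omega>" by (rule wf_edge_graph)
  obtain v p where v: "v \<in> weighted_vertices E \<omega>" "D.awalk v p (tail E \<alpha>)"
    using assms by (auto simp: weight_forest_def tree_def)
  have "(\<alpha>, 1) \<in> arcs (edge_graph E \<omega>)"
    using assms weight_pos by (auto simp: edges_def)
  then have "D.awalk (tail E \<alpha>) [(\<alpha>, 1)] (head E \<alpha>)"
    using D.arc_implies_awalk[of "(\<alpha>, 1)"] by simp
  then have "D.awalk v (p @ [(\<alpha>, 1)]) (head E \<alpha>)" using v(2) by (intro D.awalk_appendI)
  then show ?thesis unfolding weight_forest_def tree_def using v(1) by blast
qed

text \<open>By induction along walks, the forest is the least set of this kind. This is what bounds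
  it by \<open>reach\<close> later.\<close>

lemma forest_least:
  assumes "weighted_vertices E \<omega> \<subseteq> A"
    and "\<And>\<alpha>. \<alpha> \<in> arcs E \<Longrightarrow> tail E \<alpha> \<in> A \<Longrightarrow> head E \<alpha> \<in> A"
  shows "weight_forest E \<omega> \<subseteq> A"
proof -
  interpret D: wf_digraph "edge_graph E \<omega>" by (rule wf_edge_graph)
  have "v \<in> A" if "D.awalk u p v" "u \<in> A" for u v p
    using that
  proof (induction p arbitrary: u)
    case Nil
    then show ?case by (simp add: D.awalk_Nil_iff)
  next
    case (Cons e p)
    then show ?case
      using assms(2)[of "fst e"] by (cases e) (auto simp: D.awalk_Cons_iff edges_def)
  qed
  then show ?thesis using assms(1) by (auto simp: weight_forest_def tree_def)
qed

lemma weight_le_vertex_weight: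
  assumes "row_finite E" "\<alpha> \<in> arcs E"
  shows "\<omega> \<alpha> \<le> vertex_weight E \<omega> (tail E \<alpha>)"
  unfolding vertex_weight_def using assms by (intro Max_ge) (auto simp: row_finite_def)

lemma ex_max_weight:
  assumes "row_finite E" "v \<in> verts E" "out_arcs E v \<noteq> {}"
  obtains \<alpha> where "\<alpha> \<in> out_arcs E v" "\<omega> \<alpha> = vertex_weight E \<omega> v"
proof -
  have "vertex_weight E \<omega> v \<in> \<omega> ` out_arcs E v"
    unfolding vertex_weight_def using assms by (intro Max_in) (auto simp: row_finite_def)
  then show thesis using that by auto
qed

text \<open>A vertex outside the forest is not weighted, so the maximal weight of its edges is
  1.\<close>

lemma weight_outside_forest:
  assumes "row_finite E" "\<alpha> \<in> arcs E" "tail E \<alpha> \<notin> weight_forest E \<omega>"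
  shows "\<omega> \<alpha> = 1" "vertex_weight E \<omega> (tail E \<alpha>) = 1"
proof -
  have "tail E \<alpha> \<notin> weighted_vertices E \<omega>" using assms weighted_vertices_subset_forest by auto
  then have "vertex_weight E \<omega> (tail E \<alpha>) \<le> 1"
    using assms by (auto simp: weighted_vertices_def)
  then show "\<omega> \<alpha> = 1" "vertex_weight E \<omega> (tail E \<alpha>) = 1"
    using weight_le_vertex_weight[OF assms(1,2)] weight_pos[OF assms(2)] by auto
qed

section \<open>Edges of the associated graph\<close>

lemma associated_graph_simps [simp]:
  "verts (associated_graph E \<omega>) = verts E"
  "arcs (associated_graph E \<omega>) = edges E \<omega>"
  "tail (associated_graph E \<omega>) (\<alpha>, i) = (if tail E \<alpha> \<in> weight_forest E \<omega> then head E \<alpha> else tail E \<alpha>)"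
  "head (associated_graph E \<omega>) (\<alpha>, i) = (if tail E \<alpha> \<in> weight_forest E \<omega> then tail E \<alpha> else head E \<alpha>)"
  by (simp_all add: associated_graph_def)

lemma wf_associated_graph: "wf_digraph (associated_graph E \<omega>)"
  by unfold_locales (auto simp: edges_def)

text \<open>An edge that keeps its direction starts outside the forest, so only reversed edges leave
  \<open>v\<close>.\<close>

lemma out_arcs_associated_forest:
  assumes "v \<in> weight_forest E \<omega>"
  shows "out_arcs (associated_graph E \<omega>) v =
    (SIGMA \<alpha>:{\<alpha> \<in> arcs E. tail E \<alpha> \<in> weight_forest E \<omega> \<and> head E \<alpha> = v}. {1..\<omega> \<alpha>})"
  using assms by (auto simp: out_arcs_def edges_def split: if_splits)

text \<open>Reversed edges start in the forest by \<open>forest_closed\<close>, so they do not leave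
  \<open>v\<close>; the remaining edges have weight 1.\<close>

lemma out_arcs_associated_outside:
  assumes "row_finite E" "v \<notin> weight_forest E \<omega>"
  shows "out_arcs (associated_graph E \<omega>) v = (\<lambda>\<alpha>. (\<alpha>, 1)) ` out_arcs E v"
  using assms forest_closed weight_outside_forest(1)[OF assms(1)]
  by (force simp: out_arcs_def edges_def split: if_splits)

end

lemma vertex_weight_const: "out_arcs G v \<noteq> {} \<Longrightarrow> vertex_weight G (\<lambda>_. Suc 0) v = Suc 0"
  by (simp add: vertex_weight_def image_constant_conv)


section \<open>Reducible weighted graphs\<close>

text \<open>The edge letters on the right carry indices \<open>((\<alpha>, i), 1)\<close>, since the
  unweighted graph is treated as a weighted graph of constant weight 1 whose structured edges are
  the pairs \<open>(\<alpha>, i)\<close>.\<close>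

primrec to_associated :: "('v, 'e) pre_digraph \<Rightarrow> ('e \<Rightarrow> nat) \<Rightarrow> ('v, 'e) letter \<Rightarrow> ('v, 'e \<times> nat) letter" where
  "to_associated E \<omega> (Vertex v) = Vertex v"
| "to_associated E \<omega> (Edge a) =
     (if tail E (fst a) \<in> weight_forest E \<omega> then Ghost (a, 1) else Edge (a, 1))"
| "to_associated E \<omega> (Ghost a) =
     (if tail E (fst a) \<in> weight_forest E \<omega> then Edge (a, 1) else Ghost (a, 1))"

primrec from_associated :: "('v, 'e) pre_digraph \<Rightarrow> ('e \<Rightarrow> nat) \<Rightarrow> ('v, 'e \<times> nat) letter \<Rightarrow> ('v, 'e) letter" where
  "from_associated E \<omega> (Vertex v) = Vertex v"
| "from_associated E \<omega> (Edge a) =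
     (if tail E (fst (fst a)) \<in> weight_forest E \<omega> then Ghost (fst a) else Edge (fst a))"
| "from_associated E \<omega> (Ghost a) =
     (if tail E (fst (fst a)) \<in> weight_forest E \<omega> then Edge (fst a) else Ghost (fst a))"

lemma relabel_to_associated:
  "relabel (to_associated E \<omega>) (vx v) = vx v"
  "relabel (to_associated E \<omega>) (ed \<omega> \<alpha> i) = (if i \<le> \<omega> \<alpha> then
     if tail E \<alpha> \<in> weight_forest E \<omega> then gh (\<lambda>_. 1) (\<alpha>, i) 1 else ed (\<lambda>_. 1) (\<alpha>, i) 1 else 0)"
  "relabel (to_associated E \<omega>) (gh \<omega> \<alpha> i) = (if i \<le> \<omega> \<alpha> then
     if tail E \<alpha> \<in> weight_forest E \<omega> then ed (\<lambda>_. 1) (\<alpha>, i) 1 else gh (\<lambda>_. 1) (\<alpha>, i) 1 else 0)"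
  by (simp_all add: vx_def ed_def gh_def)

lemma relabel_from_associated:
  "relabel (from_associated E \<omega>) (vx v) = vx v"
  "i \<le> \<omega> \<alpha> \<Longrightarrow> relabel (from_associated E \<omega>) (ed (\<lambda>_. Suc 0) (\<alpha>, i) (Suc 0)) =
     (if tail E \<alpha> \<in> weight_forest E \<omega> then gh \<omega> \<alpha> i else ed \<omega> \<alpha> i)"
  "i \<le> \<omega> \<alpha> \<Longrightarrow> relabel (from_associated E \<omega>) (gh (\<lambda>_. Suc 0) (\<alpha>, i) (Suc 0)) =
     (if tail E \<alpha> \<in> weight_forest E \<omega> then ed \<omega> \<alpha> i else gh \<omega> \<alpha> i)"
  by (simp_all add: vx_def ed_def gh_def)

lemma card_le_one_eq: "finite A \<and> card A \<le> 1 \<Longrightarrow> a \<in> A \<Longrightarrow> b \<in> A \<Longrightarrow> a = b"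
  using card_le_Suc0_iff_eq[of A] by simp

locale reducible_graph = weighted_graph +
  assumes row_finite: "row_finite E" and reducible: "reducible E \<omega>"
begin

abbreviation "W \<equiv> weight_forest E \<omega>"
abbreviation "F \<equiv> associated_graph E \<omega>"

lemma out_unique:
  assumes "\<alpha> \<in> arcs E" "\<beta> \<in> arcs E" "tail E \<alpha> = tail E \<beta>" "tail E \<alpha> \<in> W"
  shows "\<alpha> = \<beta>"
proof -
  have "finite (out_arcs E (tail E \<alpha>)) \<and> card (out_arcs E (tail E \<alpha>)) \<le> 1"
    using bspec[OF reducible[unfolded reducible_def] assms(4)] by (rule conjunct1)
  moreover have "\<alpha> \<in> out_arcs E (tail E \<alpha>)" "\<beta> \<in> out_arcs E (tail E \<alpha>)" using assms by auto
  ultimately show ?thesis by (rule card_le_one_eq)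
qed

lemma in_unique:
  assumes "\<alpha> \<in> arcs E" "\<beta> \<in> arcs E" "head E \<alpha> = head E \<beta>" "tail E \<alpha> \<in> W" "tail E \<beta> \<in> W"
  shows "\<alpha> = \<beta>"
proof -
  let ?B = "in_arcs E (head E \<alpha>) \<inter> {\<alpha> \<in> arcs E. tail E \<alpha> \<in> W}"
  have "finite ?B \<and> card ?B \<le> 1"
    using bspec[OF reducible[unfolded reducible_def Let_def] forest_closed[OF assms(1,4)]] by (rule conjunct2)
  moreover have "\<alpha> \<in> ?B" "\<beta> \<in> ?B" using assms by auto
  ultimately show ?thesis by (rule card_le_one_eq)
qed

lemma out_arcs_forest: "\<alpha> \<in> arcs E \<Longrightarrow> tail E \<alpha> \<in> W \<Longrightarrow> out_arcs E (tail E \<alpha>) = {\<alpha>}"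
  using out_unique by auto

text \<open>Call the relations with a sum over the edges at a vertex row relations, those with a sum
  over indices column relations. Over the forest a row relation has one summand and becomes the
  column relation of two copies of an edge. The column relation of \<open>\<alpha>\<close> with
  itself becomes the row relation at its range, which in \<open>F\<close> emits exactly the copies
  of \<open>\<alpha>\<close>. Off the forest the relations carry over unchanged.\<close>

lemma relabel_relations_to_associated:
  "relabel (to_associated E \<omega>) ` lpa_relations E \<omega> \<subseteq>
   gen_ideal (letters F (\<lambda>_. 1)) (lpa_relations F (\<lambda>_. 1) :: (('a, 'b \<times> nat) letter list \<Rightarrow>\<^sub>0 'r::{ring, monoid_mult}) set)"
    (is "_ \<subseteq> ?I")
proof -
  let ?one = "\<lambda>_::'b \<times> nat. 1 :: nat"
  let ?h = "relabel (to_associated E \<omega>)"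
  interpret F: wf_digraph F by (rule wf_associated_graph)
  interpret I: free_rng_ideal "letters F ?one" ?I
    by unfold_locales (rule gen_ideal_two_sided[OF F.lpa_relations_support])
  have vv: "vx v * vx w - (if v = w then vx v else 0) \<in> ?I" if "v \<in> verts E" "w \<in> verts E" for v w
    using that by (intro subsetD[OF gen_ideal_superset] lpa_relationsI) auto
  have ends: "?h (vx (tail E \<alpha>) * ed \<omega> \<alpha> i - ed \<omega> \<alpha> i) \<in> ?I"
      "?h (ed \<omega> \<alpha> i * vx (head E \<alpha>) - ed \<omega> \<alpha> i) \<in> ?I"
      "?h (vx (head E \<alpha>) * gh \<omega> \<alpha> i - gh \<omega> \<alpha> i) \<in> ?I"
      "?h (gh \<omega> \<alpha> i * vx (tail E \<alpha>) - gh \<omega> \<alpha> i) \<in> ?I"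
    if "\<alpha> \<in> arcs E" "i \<in> {1..\<omega> \<alpha>}" for \<alpha> i
    using that lpa_relationsI(2-5)[of "(\<alpha>, i)" F 1 ?one, THEN subsetD[OF gen_ideal_superset]]
    by (auto simp: relabel_diff relabel_mult relabel_to_associated edges_def)
  show ?thesis
  proof (rule image_lpa_relations_subset)
    fix v w assume "v \<in> verts E" "w \<in> verts E"
    then show "?h (vx v * vx w - (if v = w then vx v else 0)) \<in> ?I"
      using vv[of v w] by (cases "v = w") (auto simp: relabel_diff relabel_mult relabel_to_associated)
  next
    fix v i j
    assume v: "v \<in> verts E" "out_arcs E v \<noteq> {}" and ij: "i \<in> {1..vertex_weight E \<omega> v}" "j \<in> {1..vertex_weight E \<omega> v}"
    from v(2) obtain \<alpha> where "\<alpha> \<in> out_arcs E v" by blast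
    then have \<alpha>: "\<alpha> \<in> arcs E" "tail E \<alpha> = v" by auto
    show "?h ((\<Sum>\<alpha>\<in>out_arcs E v. ed \<omega> \<alpha> i * gh \<omega> \<alpha> j) - (if i = j then vx v else 0)) \<in> ?I"
    proof (cases "v \<in> W")
      case True
      then have out: "out_arcs E v = {\<alpha>}" using out_arcs_forest \<alpha> by auto
      then have "vertex_weight E \<omega> v = \<omega> \<alpha>" by (simp add: vertex_weight_def)
      then show ?thesis
        using lpa_relationsI(7)[of "(\<alpha>, i)" F "(\<alpha>, j)" ?one, THEN subsetD[OF gen_ideal_superset]] True \<alpha> ij
        by (auto simp: out edges_def relabel_diff relabel_mult relabel_to_associated)
    next
      case False
      have w1: "\<omega> \<beta> = 1" if "\<beta> \<in> out_arcs E v" for \<beta>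
        using that weight_outside_forest(1)[OF row_finite, of \<beta>] False by auto
      have "i = 1" "j = 1" using weight_outside_forest(2)[OF row_finite, of \<alpha>] \<alpha> False ij by auto
      then have "?h ((\<Sum>\<alpha>\<in>out_arcs E v. ed \<omega> \<alpha> i * gh \<omega> \<alpha> j) - (if i = j then vx v else 0)) =
          (\<Sum>\<beta>\<in>out_arcs E v. ed ?one (\<beta>, 1) 1 * gh ?one (\<beta>, 1) 1) - vx v"
        using False by (auto simp: relabel_diff relabel_sum relabel_mult relabel_to_associated w1 intro!: sum.cong)
      also have "\<dots> = (\<Sum>e\<in>out_arcs F v. ed ?one e 1 * gh ?one e 1) - vx v"
        unfolding out_arcs_associated_outside[OF row_finite False]
        by (subst sum.reindex) (auto simp: inj_on_def)
      also have "\<dots> \<in> ?I"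
        using lpa_relationsI(6)[of v F 1 ?one 1, THEN subsetD[OF gen_ideal_superset]] v
        by (auto simp: vertex_weight_const out_arcs_associated_outside[OF row_finite False])
      finally show ?thesis .
    qed
  next
    fix \<alpha> \<beta> assume \<alpha>\<beta>: "\<alpha> \<in> arcs E" "\<beta> \<in> arcs E"
    show "?h ((\<Sum>i = 1..max (\<omega> \<alpha>) (\<omega> \<beta>). gh \<omega> \<alpha> i * ed \<omega> \<beta> i) - (if \<alpha> = \<beta> then vx (head E \<alpha>) else 0)) \<in> ?I"
    proof (cases "tail E \<alpha> = tail E \<beta>")
      case False
      \<comment> \<open>For distinct sources every summand lies in the ideal by itself, since the
        two vertices in the middle are orthogonal.\<close>
      have "?h (gh \<omega> \<alpha> i * ed \<omega> \<beta> i) \<in> ?I" if i: "1 \<le> i" for i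
      proof (cases "i \<le> \<omega> \<alpha> \<and> i \<le> \<omega> \<beta>")
        case True
        have "?h (gh \<omega> \<alpha> i) * ?h (ed \<omega> \<beta> i) \<in> ?I"
        proof (rule I.orthogonal[of _ "vx (tail E \<alpha>)" "vx (tail E \<beta>)"])
          show "?h (gh \<omega> \<alpha> i) * vx (tail E \<alpha>) - ?h (gh \<omega> \<alpha> i) \<in> ?I"
            using ends(4)[of \<alpha> i] \<alpha>\<beta> i True by (simp add: relabel_diff relabel_mult relabel_to_associated(1))
          show "vx (tail E \<beta>) * ?h (ed \<omega> \<beta> i) - ?h (ed \<omega> \<beta> i) \<in> ?I"
            using ends(1)[of \<beta> i] \<alpha>\<beta> i True by (simp add: relabel_diff relabel_mult relabel_to_associated(1))
          show "vx (tail E \<alpha>) * vx (tail E \<beta>) \<in> ?I"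
            using vv[of "tail E \<alpha>" "tail E \<beta>"] \<alpha>\<beta> False by simp
        qed (use \<alpha>\<beta> i True in \<open>auto simp: relabel_to_associated edges_def intro!: ed_support gh_support vx_support\<close>)
        then show ?thesis by (simp add: relabel_mult)
      qed (use I.zero in \<open>auto simp: relabel_mult relabel_to_associated\<close>)
      then have "(\<Sum>i = 1..max (\<omega> \<alpha>) (\<omega> \<beta>). ?h (gh \<omega> \<alpha> i * ed \<omega> \<beta> i)) \<in> ?I"
        by (intro I.sum) auto
      then show ?thesis using False by (auto simp: relabel_diff relabel_sum)
    next
      case eq: True
      show ?thesis
      proof (cases "tail E \<alpha> \<in> W")
        case True
        then have "\<alpha> = \<beta>" using out_unique \<alpha>\<beta> eq by auto
        have "{\<alpha>' \<in> arcs E. tail E \<alpha>' \<in> W \<and> head E \<alpha>' = head E \<alpha>} = {\<alpha>}"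
          using in_unique \<alpha>\<beta> True by auto
        then have out: "out_arcs F (head E \<alpha>) = (\<lambda>i. (\<alpha>, i)) ` {1..\<omega> \<alpha>}"
          using out_arcs_associated_forest forest_closed[OF \<alpha>\<beta>(1) True] by auto
        have "?h ((\<Sum>i = 1..max (\<omega> \<alpha>) (\<omega> \<beta>). gh \<omega> \<alpha> i * ed \<omega> \<beta> i) - (if \<alpha> = \<beta> then vx (head E \<alpha>) else 0))
          = (\<Sum>i = 1..\<omega> \<alpha>. ed ?one (\<alpha>, i) 1 * gh ?one (\<alpha>, i) 1) - vx (head E \<alpha>)"
          using True \<open>\<alpha> = \<beta>\<close>
          by (auto simp: relabel_diff relabel_sum relabel_mult relabel_to_associated intro!: sum.cong)
        also have "\<dots> = (\<Sum>e\<in>out_arcs F (head E \<alpha>). ed ?one e 1 * gh ?one e 1) - vx (head E \<alpha>)"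
          unfolding out by (subst sum.reindex) (auto simp: inj_on_def)
        also have "\<dots> \<in> ?I"
          using lpa_relationsI(6)[of "head E \<alpha>" F 1 ?one 1, THEN subsetD[OF gen_ideal_superset]] \<alpha>\<beta>
            weight_pos[of \<alpha>]
          by (auto simp: vertex_weight_const out)
        finally show ?thesis .
      next
        case False
        then have "\<omega> \<alpha> = 1" "\<omega> \<beta> = 1" using weight_outside_forest(1)[OF row_finite] \<alpha>\<beta> eq by auto
        then show ?thesis
          using lpa_relationsI(7)[of "(\<alpha>, 1)" F "(\<beta>, 1)" ?one, THEN subsetD[OF gen_ideal_superset]] False \<alpha>\<beta> eq
          by (auto simp: edges_def relabel_diff relabel_mult relabel_to_associated)
      qed
    qed
  qed (use ends in auto)
qed

text \<open>The exchange read backwards: a row relation of \<open>F\<close> over the forest is the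
  column relation of the one edge of \<open>E\<close> that arrives from the forest, and the column
  relation of two copies of an edge is a row relation of \<open>E\<close>.\<close>

lemma relabel_relations_from_associated:
  "relabel (from_associated E \<omega>) ` lpa_relations F (\<lambda>_. 1) \<subseteq>
   gen_ideal (letters E \<omega>) (lpa_relations E \<omega> :: (('a, 'b) letter list \<Rightarrow>\<^sub>0 'r::{ring, monoid_mult}) set)"
    (is "_ \<subseteq> ?I")
proof -
  let ?one = "\<lambda>_::'b \<times> nat. 1 :: nat"
  let ?h = "relabel (from_associated E \<omega>)"
  interpret I: free_rng_ideal "letters E \<omega>" ?I
    by unfold_locales (rule gen_ideal_two_sided[OF lpa_relations_support])
  have vv: "vx v * vx w - (if v = w then vx v else 0) \<in> ?I" if "v \<in> verts E" "w \<in> verts E" for v w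
    using that by (intro subsetD[OF gen_ideal_superset] lpa_relationsI) auto
  have "?h (vx (tail F (\<alpha>, i)) * ed ?one (\<alpha>, i) 1 - ed ?one (\<alpha>, i) 1) \<in> ?I \<and>
      ?h (ed ?one (\<alpha>, i) 1 * vx (head F (\<alpha>, i)) - ed ?one (\<alpha>, i) 1) \<in> ?I \<and>
      ?h (vx (head F (\<alpha>, i)) * gh ?one (\<alpha>, i) 1 - gh ?one (\<alpha>, i) 1) \<in> ?I \<and>
      ?h (gh ?one (\<alpha>, i) 1 * vx (tail F (\<alpha>, i)) - gh ?one (\<alpha>, i) 1) \<in> ?I"
    if "\<alpha> \<in> arcs E" "i \<in> {1..\<omega> \<alpha>}" for \<alpha> i
    using that lpa_relationsI(2-5)[of \<alpha> E i \<omega>, THEN subsetD[OF gen_ideal_superset]]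
    by (auto simp: relabel_diff relabel_mult relabel_from_associated)
  then have ends: "?h (vx (tail F e) * ed ?one e 1 - ed ?one e 1) \<in> ?I"
      "?h (ed ?one e 1 * vx (head F e) - ed ?one e 1) \<in> ?I"
      "?h (vx (head F e) * gh ?one e 1 - gh ?one e 1) \<in> ?I"
      "?h (gh ?one e 1 * vx (tail F e) - gh ?one e 1) \<in> ?I"
    if "e \<in> edges E \<omega>" for e
    using that unfolding edges_def by blast+
  have supp: "?h (ed ?one e 1) \<in> nonempty_support (letters E \<omega>)"
      "?h (gh ?one e 1) \<in> nonempty_support (letters E \<omega>)" if "e \<in> edges E \<omega>" for e
    using that by (cases e, auto simp: relabel_from_associated edges_def intro!: ed_support gh_support)+
  have F_verts: "tail F e \<in> verts E" if "e \<in> edges E \<omega>" for e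
    using that by (cases e) (auto simp: edges_def)
  show ?thesis
  proof (rule image_lpa_relations_subset)
    fix v w assume "v \<in> verts F" "w \<in> verts F"
    then show "?h (vx v * vx w - (if v = w then vx v else 0)) \<in> ?I"
      using vv[of v w] by (cases "v = w") (auto simp: relabel_diff relabel_mult relabel_from_associated)
  next
    fix v i j
    assume v: "v \<in> verts F" "out_arcs F v \<noteq> {}"
      and ij: "i \<in> {1..vertex_weight F ?one v}" "j \<in> {1..vertex_weight F ?one v}"
    have ij1: "i = 1" "j = 1" using ij vertex_weight_const[OF v(2)] by auto
    obtain \<alpha> k where \<alpha>: "\<alpha> \<in> arcs E" "k \<in> {1..\<omega> \<alpha>}" "tail F (\<alpha>, k) = v"
      using v(2) by (auto simp: edges_def out_arcs_def)
    show "?h ((\<Sum>e\<in>out_arcs F v. ed ?one e i * gh ?one e j) - (if i = j then vx v else 0)) \<in> ?I"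
    proof (cases "v \<in> W")
      case True
      then have \<alpha>W: "tail E \<alpha> \<in> W" "head E \<alpha> = v" using \<alpha> by (auto split: if_splits)
      then have "{\<alpha>' \<in> arcs E. tail E \<alpha>' \<in> W \<and> head E \<alpha>' = v} = {\<alpha>}"
        using in_unique \<alpha> by auto
      then have out: "out_arcs F v = (\<lambda>i. (\<alpha>, i)) ` {1..\<omega> \<alpha>}"
        using out_arcs_associated_forest[OF True] by auto
      have "?h ((\<Sum>e\<in>out_arcs F v. ed ?one e i * gh ?one e j) - (if i = j then vx v else 0)) =
          (\<Sum>i = 1..max (\<omega> \<alpha>) (\<omega> \<alpha>). gh \<omega> \<alpha> i * ed \<omega> \<alpha> i) - (if \<alpha> = \<alpha> then vx (head E \<alpha>) else 0)"
        unfolding out ij1 using \<alpha>W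
        by (subst sum.reindex)
          (auto simp: inj_on_def relabel_diff relabel_sum relabel_mult relabel_from_associated intro!: sum.cong)
      also have "\<dots> \<in> ?I" using \<alpha> by (intro subsetD[OF gen_ideal_superset] lpa_relationsI)
      finally show ?thesis .
    next
      case False
      then have out: "out_arcs F v = (\<lambda>\<alpha>. (\<alpha>, 1)) ` out_arcs E v"
        by (rule out_arcs_associated_outside[OF row_finite])
      have w1: "\<omega> \<beta> = 1" if "\<beta> \<in> out_arcs E v" for \<beta>
        using that weight_outside_forest(1)[OF row_finite, of \<beta>] False by auto
      have "?h ((\<Sum>e\<in>out_arcs F v. ed ?one e i * gh ?one e j) - (if i = j then vx v else 0)) =
          (\<Sum>\<alpha>\<in>out_arcs E v. ed \<omega> \<alpha> 1 * gh \<omega> \<alpha> 1) - (if (1::nat) = 1 then vx v else 0)"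
        unfolding out ij1 using False
        by (subst sum.reindex)
          (auto simp: inj_on_def relabel_diff relabel_sum relabel_mult relabel_from_associated w1 intro!: sum.cong)
      also have "\<dots> \<in> ?I"
      proof (intro subsetD[OF gen_ideal_superset] lpa_relationsI)
        show "out_arcs E v \<noteq> {}" using v(2) out by auto
        then obtain \<beta> where "\<beta> \<in> out_arcs E v" by blast
        then show "1 \<in> {1..vertex_weight E \<omega> v}" "1 \<in> {1..vertex_weight E \<omega> v}"
          using weight_outside_forest(2)[OF row_finite, of \<beta>] False by auto
      qed (use v in auto)
      finally show ?thesis .
    qed
  next
    fix e f assume ef: "e \<in> arcs F" "f \<in> arcs F"
    obtain \<alpha> i \<beta> j where \<alpha>\<beta>: "e = (\<alpha>, i)" "f = (\<beta>, j)" by (meson surj_pair)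
    then have arcs: "\<alpha> \<in> arcs E" "\<beta> \<in> arcs E" "i \<in> {1..\<omega> \<alpha>}" "j \<in> {1..\<omega> \<beta>}"
      using ef by (auto simp: edges_def)
    have "?h (gh ?one e 1) * ?h (ed ?one f 1) - (if e = f then vx (head F e) else 0) \<in> ?I"
    proof (cases "tail F e = tail F f")
      case False
      have "?h (gh ?one e 1) * ?h (ed ?one f 1) \<in> ?I"
      proof (rule I.orthogonal[of _ "vx (tail F e)" "vx (tail F f)"])
        show "?h (gh ?one e 1) * vx (tail F e) - ?h (gh ?one e 1) \<in> ?I"
          using ends(4)[of e] ef by (simp add: relabel_diff relabel_mult relabel_from_associated(1))
        show "vx (tail F f) * ?h (ed ?one f 1) - ?h (ed ?one f 1) \<in> ?I"
          using ends(1)[of f] ef by (simp add: relabel_diff relabel_mult relabel_from_associated(1))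
        show "vx (tail F e) * vx (tail F f) \<in> ?I"
          using vv[of "tail F e" "tail F f"] F_verts ef False by simp
      qed (use supp(1)[of f] supp(2)[of e] F_verts[of f] ef in \<open>auto intro!: vx_support\<close>)
      then show ?thesis using False by auto
    next
      case eq: True
      show ?thesis
      proof (cases "tail F e \<in> W")
        case True
        then have W: "tail E \<alpha> \<in> W" "tail E \<beta> \<in> W" "head E \<alpha> = head E \<beta>"
          using eq \<alpha>\<beta> by (auto split: if_splits)
        \<comment> \<open>Both edges are reversed, so \<open>e\<close> and \<open>f\<close> are
          copies of one structured edge. Their column relation is the row relation of
          \<open>E\<close> at its source for the rows \<open>i\<close> and \<open>j\<close>.\<close>
        then have "\<alpha> = \<beta>" using in_unique arcs by auto
        have out: "out_arcs E (tail E \<alpha>) = {\<alpha>}" using out_arcs_forest arcs W by auto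
        then have "vertex_weight E \<omega> (tail E \<alpha>) = \<omega> \<alpha>" by (simp add: vertex_weight_def)
        then have "(\<Sum>\<alpha>\<in>out_arcs E (tail E \<alpha>). ed \<omega> \<alpha> i * gh \<omega> \<alpha> j) -
            (if i = j then vx (tail E \<alpha>) else 0) \<in> ?I"
          using arcs \<open>\<alpha> = \<beta>\<close> out by (intro subsetD[OF gen_ideal_superset] lpa_relationsI) auto
        then have "ed \<omega> \<alpha> i * gh \<omega> \<alpha> j - (if i = j then vx (tail E \<alpha>) else 0) \<in> ?I"
          unfolding out by simp
        then show ?thesis
          using W arcs \<open>\<alpha> = \<beta>\<close> by (cases "i = j") (auto simp: \<alpha>\<beta> relabel_from_associated)
      next
        case False
        then have W: "tail E \<alpha> \<notin> W" "tail E \<beta> \<notin> W"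
          using False eq \<alpha>\<beta> forest_closed[of \<alpha>] forest_closed[of \<beta>] arcs by (auto split: if_splits)
        then have w: "\<omega> \<alpha> = 1" "\<omega> \<beta> = 1" using weight_outside_forest(1)[OF row_finite] arcs by auto
        have "(\<Sum>i = 1..max (\<omega> \<alpha>) (\<omega> \<beta>). gh \<omega> \<alpha> i * ed \<omega> \<beta> i) -
          (if \<alpha> = \<beta> then vx (head E \<alpha>) else 0) \<in> ?I"
          using arcs by (intro subsetD[OF gen_ideal_superset] lpa_relationsI)
        then show ?thesis
          using W arcs w by (auto simp: \<alpha>\<beta> relabel_from_associated split: if_splits)
      qed
    qed
    then show "?h ((\<Sum>i = 1..max (?one e) (?one f). gh ?one e i * ed ?one f i) -
        (if e = f then vx (head F e) else 0)) \<in> ?I"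
      by (cases "e = f") (simp_all add: relabel_diff relabel_mult relabel_from_associated(1))
  qed (use ends in auto)
qed

lemma simple_iff_associated:
  "simple_rng (weighted_lpa TYPE('r::{ring, monoid_mult}) E \<omega>) \<longleftrightarrow>
   simple_rng (lpa TYPE('r) (associated_graph E \<omega>))"
  unfolding lpa_def weighted_lpa_eq
proof (rule simple_quotient_relabel)
  interpret F: wf_digraph F by (rule wf_associated_graph)
  show "to_associated E \<omega> ` letters E \<omega> \<subseteq> letters F (\<lambda>_. 1)"
    by (auto simp: letters_def edges_def)
  show "from_associated E \<omega> ` letters F (\<lambda>_. 1) \<subseteq> letters E \<omega>"
    by (auto simp: letters_def edges_def)
  show "from_associated E \<omega> (to_associated E \<omega> x) = x" if "x \<in> letters E \<omega>" for x
    by (cases x) auto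
  show "to_associated E \<omega> (from_associated E \<omega> y) = y" if "y \<in> letters F (\<lambda>_. 1)" for y
    using that by (cases y) (auto simp: letters_def edges_def)
qed (rule relabel_relations_to_associated relabel_relations_from_associated lpa_relations_support
    wf_digraph.lpa_relations_support[OF wf_associated_graph])+

end

section \<open>Representations by partial injections\<close>

lemma ex1_unique: "\<exists>!x. P x \<Longrightarrow> P a \<Longrightarrow> P b \<Longrightarrow> a = b"
  by blast

text \<open>Turns the unique existence in \<open>branching_at\<close> into a diagonal matrix entry
  1.\<close>

lemma sum_if_ex1:
  assumes "finite A" "\<exists>!a. a \<in> A \<and> P a"
  shows "(\<Sum>a\<in>A. if P a then 1 else 0) = (1 :: 'r::{ring, monoid_mult})"
proof -
  from assms(2) obtain a where a: "a \<in> A \<and> P a" and u: "\<forall>b. b \<in> A \<and> P b \<longrightarrow> b = a" by (rule ex1E)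
  have "P b \<longleftrightarrow> b = a" if "b \<in> A" for b using a u that by blast
  then have "(\<Sum>b\<in>A. if P b then 1 else 0) = (\<Sum>b\<in>A. if b = a then 1 else 0 :: 'r)"
    by (intro sum.cong) simp_all
  then show ?thesis using assms(1) a by simp
qed

text \<open>
  A branching system lets \<open>\<alpha>\<^sub>i\<close> act from \<open>{s(\<alpha>)} \<times> \<nat>\<close> to \<open>{r(\<alpha>)} \<times> \<nat>\<close> by the partial
  injection \<open>F \<alpha> i\<close> and \<open>\<alpha>\<^sub>i\<^sup>*\<close> by its inverse. The second and the third condition are
  the relations (3) and (4).
\<close>

definition branching_at ::
    "('v, 'e) pre_digraph \<Rightarrow> ('e \<Rightarrow> nat) \<Rightarrow> ('e \<Rightarrow> nat \<Rightarrow> (nat \<times> nat) set) \<Rightarrow> 'v \<Rightarrow> bool" where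
  "branching_at E \<omega> F v \<longleftrightarrow>
     (\<forall>\<alpha>\<in>out_arcs E v. \<forall>i\<in>{1..\<omega> \<alpha>}. single_valued (F \<alpha> i) \<and> single_valued ((F \<alpha> i)\<inverse>)) \<and>
     (\<forall>i\<in>{1..vertex_weight E \<omega> v}. \<forall>n. \<exists>!\<alpha>. \<alpha> \<in> out_arcs E v \<and> i \<le> \<omega> \<alpha> \<and> n \<in> Domain (F \<alpha> i)) \<and>
     (\<forall>\<alpha>\<in>out_arcs E v. \<forall>m. \<exists>!i. i \<in> {1..\<omega> \<alpha>} \<and> m \<in> Range (F \<alpha> i))"

definition branching_system ::
    "('v, 'e) pre_digraph \<Rightarrow> ('e \<Rightarrow> nat) \<Rightarrow> ('e \<Rightarrow> nat \<Rightarrow> (nat \<times> nat) set) \<Rightarrow> bool" where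
  "branching_system E \<omega> F \<longleftrightarrow> (\<forall>v\<in>verts E. out_arcs E v \<noteq> {} \<longrightarrow> branching_at E \<omega> F v)"

fun letter_rel ::
    "('v, 'e) pre_digraph \<Rightarrow> ('e \<Rightarrow> nat \<Rightarrow> (nat \<times> nat) set) \<Rightarrow> ('v, 'e) letter \<Rightarrow> (('v \<times> nat) \<times> ('v \<times> nat)) set" where
  "letter_rel E F (Vertex v) = {((v, n), (v, n)) | n. True}"
| "letter_rel E F (Edge (\<alpha>, i)) = {((tail E \<alpha>, n), (head E \<alpha>, m)) | n m. (n, m) \<in> F \<alpha> i}"
| "letter_rel E F (Ghost (\<alpha>, i)) = {((head E \<alpha>, m), (tail E \<alpha>, n)) | n m. (n, m) \<in> F \<alpha> i}"

text \<open>\<open>O\<close> composes from left to right, as words are read. The empty word, which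
  carries the scalars, acts as the identity.\<close>

primrec word_rel ::
    "('v, 'e) pre_digraph \<Rightarrow> ('e \<Rightarrow> nat \<Rightarrow> (nat \<times> nat) set) \<Rightarrow> ('v, 'e) letter list \<Rightarrow> (('v \<times> nat) \<times> ('v \<times> nat)) set" where
  "word_rel E F [] = Id"
| "word_rel E F (x # w) = letter_rel E F x O word_rel E F w"

lemma word_rel_append: "word_rel E F (u @ w) = word_rel E F u O word_rel E F w"
  by (induction u) (auto simp: O_assoc)

text \<open>The entry at \<open>(s, t)\<close> of the matrix by which an element of the free ring acts.\<close>

definition entry ::
    "('v, 'e) pre_digraph \<Rightarrow> ('e \<Rightarrow> nat \<Rightarrow> (nat \<times> nat) set) \<Rightarrow> 'v \<times> nat \<Rightarrow> 'v \<times> nat \<Rightarrow>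
     (('v, 'e) letter list \<Rightarrow>\<^sub>0 'r::ring) \<Rightarrow> 'r" where
  "entry E F s t f = (\<Sum>w\<in>Poly_Mapping.keys f. if (s, t) \<in> word_rel E F w then Poly_Mapping.lookup f w else 0)"

lemma entry_superset:
  assumes "finite A" "Poly_Mapping.keys f \<subseteq> A"
  shows "entry E F s t f = (\<Sum>w\<in>A. if (s, t) \<in> word_rel E F w then Poly_Mapping.lookup f w else 0)"
  unfolding entry_def using assms
  by (intro sum.mono_neutral_left) (auto simp: in_keys_iff)

lemma entry_single:
  "entry E F s t (Poly_Mapping.single w r) = (if (s, t) \<in> word_rel E F w then r else 0)"
  by (subst entry_superset[of "{w}"]) auto

lemma entry_zero [simp]: "entry E F s t 0 = 0"
  by (simp add: entry_def)

lemma entry_add: "entry E F s t (f + g) = entry E F s t f + entry E F s t g"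
proof -
  let ?A = "Poly_Mapping.keys f \<union> Poly_Mapping.keys g"
  have "entry E F s t (f + g) =
      (\<Sum>w\<in>?A. if (s, t) \<in> word_rel E F w then Poly_Mapping.lookup (f + g) w else 0)"
    using Poly_Mapping.keys_add[of f g] by (intro entry_superset) auto
  also have "\<dots> = (\<Sum>w\<in>?A. (if (s, t) \<in> word_rel E F w then Poly_Mapping.lookup f w else 0) +
      (if (s, t) \<in> word_rel E F w then Poly_Mapping.lookup g w else 0))"
    by (intro sum.cong) (auto simp: lookup_add)
  also have "\<dots> = entry E F s t f + entry E F s t g"
    by (simp add: entry_superset[of ?A f] entry_superset[of ?A g] sum.distrib)
  finally show ?thesis .
qed

lemma entry_uminus: "entry E F s t (- f) = - entry E F s t f"
  using entry_add[of E F s t f "- f"] by (simp add: minus_unique)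

lemma entry_diff: "entry E F s t (f - g) = entry E F s t f - entry E F s t g"
  using entry_add[of E F s t f "- g"] by (simp add: entry_uminus)

lemma entry_sum: "entry E F s t (sum f A) = (\<Sum>i\<in>A. entry E F s t (f i))"
  by (induction A rule: infinite_finite_induct) (auto simp: entry_add)

text \<open>Row \<open>s\<close> of the matrix of a monomial can be nonzero only in column
  \<open>s'\<close>, so one term of the matrix product survives. The next three lemmas treat empty
  rows and, dually, columns.\<close>

lemma entry_single_mult:
  assumes "(s, s') \<in> word_rel E F v" "single_valued (word_rel E F v)"
  shows "entry E F s t (Poly_Mapping.single v r * f) = r * entry E F s' t f"
proof (induction f rule: poly_mapping_induct_single)
  case (single w q)
  have "(s, t) \<in> word_rel E F v O word_rel E F w \<longleftrightarrow> (s', t) \<in> word_rel E F w"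
    using assms by (auto dest: single_valuedD)
  then show ?case by (simp add: mult_single plus_list_def entry_single word_rel_append)
qed (simp_all add: distrib_left entry_add)

lemma entry_single_mult_0:
  assumes "s \<notin> Domain (word_rel E F v)"
  shows "entry E F s t (Poly_Mapping.single v r * f) = 0"
proof (induction f rule: poly_mapping_induct_single)
  case (single w q)
  have "(s, t) \<notin> word_rel E F v O word_rel E F w" using assms by auto
  then show ?case by (simp add: mult_single plus_list_def entry_single word_rel_append)
qed (simp_all add: distrib_left entry_add)

lemma entry_mult_single:
  assumes "(t', t) \<in> word_rel E F v" "single_valued ((word_rel E F v)\<inverse>)"
  shows "entry E F s t (f * Poly_Mapping.single v r) = entry E F s t' f * r"
proof (induction f rule: poly_mapping_induct_single)
  case (single w q)
  have "(s, t) \<in> word_rel E F w O word_rel E F v \<longleftrightarrow> (s, t') \<in> word_rel E F w"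
    using assms by (auto dest: single_valuedD)
  then show ?case by (simp add: mult_single plus_list_def entry_single word_rel_append)
qed (simp_all add: distrib_right entry_add)

lemma entry_mult_single_0:
  assumes "t \<notin> Range (word_rel E F v)"
  shows "entry E F s t (f * Poly_Mapping.single v r) = 0"
proof (induction f rule: poly_mapping_induct_single)
  case (single w q)
  have "(s, t) \<notin> word_rel E F w O word_rel E F v" using assms by auto
  then show ?case by (simp add: mult_single plus_list_def entry_single word_rel_append)
qed (simp_all add: distrib_right entry_add)

section \<open>The representation given by a branching system and its annihilator\<close>

locale branching_graph = weighted_graph +
  fixes F :: "'b \<Rightarrow> nat \<Rightarrow> (nat \<times> nat) set"
  assumes row_finite: "row_finite E" and branching: "branching_system E \<omega> F"
begin

lemma branching_at_tail: "\<alpha> \<in> arcs E \<Longrightarrow> branching_at E \<omega> F (tail E \<alpha>)"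
  using branching by (force simp: branching_system_def)

lemma injective:
  assumes "\<alpha> \<in> arcs E" "i \<in> {1..\<omega> \<alpha>}"
  shows "single_valued (F \<alpha> i)" "single_valued ((F \<alpha> i)\<inverse>)"
  using branching_at_tail[OF assms(1)] assms by (auto simp: branching_at_def)

text \<open>The pieces \<open>F \<alpha> i\<close> at a vertex form an array with rows
  \<open>i\<close> and columns \<open>\<alpha>\<close>. Domains partition \<open>\<nat>\<close>
  along a row, ranges along a column.\<close>

lemma row:
  assumes "v \<in> verts E" "out_arcs E v \<noteq> {}" "i \<in> {1..vertex_weight E \<omega> v}"
  shows "\<exists>!\<alpha>. \<alpha> \<in> out_arcs E v \<and> i \<le> \<omega> \<alpha> \<and> n \<in> Domain (F \<alpha> i)"
proof -
  have "branching_at E \<omega> F v" using branching assms by (simp add: branching_system_def)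
  then have "\<forall>i\<in>{1..vertex_weight E \<omega> v}. \<forall>n. \<exists>!\<alpha>. \<alpha> \<in> out_arcs E v \<and> i \<le> \<omega> \<alpha> \<and> n \<in> Domain (F \<alpha> i)"
    unfolding branching_at_def by (elim conjE)
  from bspec[OF this assms(3)] show ?thesis by (rule spec)
qed

lemma column:
  assumes "\<alpha> \<in> arcs E"
  shows "\<exists>!i. i \<in> {1..\<omega> \<alpha>} \<and> m \<in> Range (F \<alpha> i)"
proof -
  have "\<forall>\<alpha>\<in>out_arcs E (tail E \<alpha>). \<forall>m. \<exists>!i. i \<in> {1..\<omega> \<alpha>} \<and> m \<in> Range (F \<alpha> i)"
    using branching_at_tail[OF assms] unfolding branching_at_def by (elim conjE)
  from bspec[OF this, of \<alpha>] show ?thesis using assms by simp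
qed

lemma row_unique:
  assumes "\<alpha> \<in> arcs E" "\<beta> \<in> arcs E" "tail E \<alpha> = tail E \<beta>" "i \<in> {1..\<omega> \<alpha>}" "i \<le> \<omega> \<beta>"
    and "n \<in> Domain (F \<alpha> i)" "n \<in> Domain (F \<beta> i)"
  shows "\<alpha> = \<beta>"
proof -
  have i: "i \<in> {1..vertex_weight E \<omega> (tail E \<alpha>)}"
    using weight_le_vertex_weight[OF row_finite assms(1)] assms(4) by auto
  have v: "tail E \<alpha> \<in> verts E" "out_arcs E (tail E \<alpha>) \<noteq> {}" using assms(1) by auto
  show ?thesis by (rule ex1_unique[OF row[OF v i, of n]]) (use assms in auto)
qed

lemma column_unique:
  assumes "\<alpha> \<in> arcs E" "i \<in> {1..\<omega> \<alpha>}" "j \<in> {1..\<omega> \<alpha>}" "m \<in> Range (F \<alpha> i)" "m \<in> Range (F \<alpha> j)"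
  shows "i = j"
  by (rule ex1_unique[OF column[OF assms(1), of m]]) (use assms in auto)

lemma letter_rel_injective:
  assumes "x \<in> letters E \<omega>"
  shows "single_valued (letter_rel E F x)" "single_valued ((letter_rel E F x)\<inverse>)"
proof -
  consider v where "x = Vertex v" | \<alpha> i where "x = Edge (\<alpha>, i)" "\<alpha> \<in> arcs E" "i \<in> {1..\<omega> \<alpha>}"
    | \<alpha> i where "x = Ghost (\<alpha>, i)" "\<alpha> \<in> arcs E" "i \<in> {1..\<omega> \<alpha>}"
    using assms by (auto simp: letters_def edges_def)
  then show "single_valued (letter_rel E F x)" "single_valued ((letter_rel E F x)\<inverse>)"
    by (cases, use injective in \<open>auto simp: single_valued_def\<close>)+
qed

lemma word_rel_injective:
  assumes "w \<in> lists (letters E \<omega>)"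
  shows "single_valued (word_rel E F w)" "single_valued ((word_rel E F w)\<inverse>)"
  using assms
  by (induction w) (auto intro: single_valued_relcomp simp: converse_relcomp letter_rel_injective)

text \<open>The annihilator of the representation within the free ring.\<close>

definition kernel :: "(('a, 'b) letter list \<Rightarrow>\<^sub>0 'r::{ring, monoid_mult}) set" where
  "kernel = {f \<in> nonempty_support (letters E \<omega>). \<forall>s t. entry E F s t f = 0}"

lemma entry_monom_mult:
  assumes "\<And>s t. entry E F s t f = 0" "w \<in> lists (letters E \<omega>)"
  shows "entry E F s t (Poly_Mapping.single w r * f) = 0" "entry E F s t (f * Poly_Mapping.single w r) = 0"
proof -
  show "entry E F s t (Poly_Mapping.single w r * f) = 0"
  proof (cases "s \<in> Domain (word_rel E F w)")
    case True
    then obtain s' where "(s, s') \<in> word_rel E F w" by (rule DomainE)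
    from entry_single_mult[OF this word_rel_injective(1)[OF assms(2)]]
    have "entry E F s t (Poly_Mapping.single w r * f) = r * entry E F s' t f" .
    then show ?thesis unfolding assms(1) by simp
  qed (rule entry_single_mult_0)
  show "entry E F s t (f * Poly_Mapping.single w r) = 0"
  proof (cases "t \<in> Range (word_rel E F w)")
    case True
    then obtain t' where "(t', t) \<in> word_rel E F w" by (rule RangeE)
    from entry_mult_single[OF this word_rel_injective(2)[OF assms(2)]]
    have "entry E F s t (f * Poly_Mapping.single w r) = entry E F s t' f * r" .
    then show ?thesis unfolding assms(1) by simp
  qed (rule entry_mult_single_0)
qed

text \<open>The factor \<open>g\<close> is a sum of monomials, and multiplication by a monomial only
  moves and scales matrix entries, because words act by partial injections.\<close>

lemma kernel_two_sided: "two_sided_ideal kernel (free_rng (letters E \<omega>))"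
proof -
  have mult: "entry E F s t (g * f) = 0" "entry E F s t (f * g) = 0"
    if f: "\<And>s t. entry E F s t f = 0" and g: "g \<in> nonempty_support (letters E \<omega>)"
    for f g :: "('a, 'b) letter list \<Rightarrow>\<^sub>0 'r::{ring, monoid_mult}" and s t
  proof -
    have *: "g = (\<Sum>w\<in>Poly_Mapping.keys g. Poly_Mapping.single w (Poly_Mapping.lookup g w))"
      by (rule poly_mapping_sum_single)
    have w: "w \<in> lists (letters E \<omega>)" if "w \<in> Poly_Mapping.keys g" for w
      using g that by (auto simp: nonempty_support_def)
    show "entry E F s t (g * f) = 0"
      by (subst *) (simp add: sum_distrib_right entry_sum entry_monom_mult[OF f w])
    show "entry E F s t (f * g) = 0"
      by (subst *) (simp add: sum_distrib_left entry_sum entry_monom_mult[OF f w])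
  qed
  show ?thesis
    unfolding two_sided_ideal_free_rng kernel_def
    by (intro conjI ballI) (simp_all add: Collect_mono_iff entry_add entry_uminus support_add support_mult mult
        del: split_paired_All)
qed

lemma kernel_scalar: "f \<in> kernel \<Longrightarrow> Poly_Mapping.single [] r * f \<in> kernel"
  by (auto simp: kernel_def support_scalar intro!: entry_monom_mult)

text \<open>A point in the ranges of both pieces forces \<open>i = j\<close>, since ranges in a
  column are disjoint; by injectivity the way back ends at the start.\<close>

lemma edge_ghost:
  assumes "\<alpha> \<in> arcs E" "i \<in> {1..\<omega> \<alpha>}" "j \<in> {1..\<omega> \<alpha>}"
  shows "(s, t) \<in> letter_rel E F (Edge (\<alpha>, i)) O letter_rel E F (Ghost (\<alpha>, j)) \<longleftrightarrow>
    i = j \<and> s = t \<and> fst s = tail E \<alpha> \<and> snd s \<in> Domain (F \<alpha> i)"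
  using column_unique[OF assms] injective(2)[OF assms(1,2)]
  by (cases s; cases t) (fastforce dest: single_valuedD)

text \<open>Dual to \<open>edge_ghost\<close>: domains in a row are disjoint, which forces
  \<open>\<alpha> = \<beta>\<close>.\<close>

lemma ghost_edge:
  assumes "\<alpha> \<in> arcs E" "\<beta> \<in> arcs E" "i \<in> {1..\<omega> \<alpha>}" "i \<le> \<omega> \<beta>"
  shows "(s, t) \<in> letter_rel E F (Ghost (\<alpha>, i)) O letter_rel E F (Edge (\<beta>, i)) \<longleftrightarrow>
    \<alpha> = \<beta> \<and> s = t \<and> fst s = head E \<alpha> \<and> snd s \<in> Range (F \<alpha> i)"
proof -
  have "\<alpha> = \<beta>" if "tail E \<alpha> = tail E \<beta>" "(n, m) \<in> F \<alpha> i" "(n, m') \<in> F \<beta> i" for n m m'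
    using row_unique[OF assms(1,2) that(1) assms(3,4)] that by blast
  then show ?thesis
    using injective(1)[OF assms(1,3)]
    by (cases s; cases t) (fastforce dest: single_valuedD)
qed

text \<open>By \<open>edge_ghost\<close> the summands of a row relation act as diagonal projections
  onto the domains in a row. These partition the points over \<open>v\<close>, so the sum acts as
  \<open>v\<close>. The ranges in a column do the same for the column relations.\<close>

lemma relations_subset_kernel:
  "lpa_relations E \<omega> \<subseteq> (kernel :: (('a, 'b) letter list \<Rightarrow>\<^sub>0 'r::{ring, monoid_mult}) set)"
proof -
  have "(\<lambda>f. f) ` lpa_relations E \<omega> \<subseteq> {f :: ('a, 'b) letter list \<Rightarrow>\<^sub>0 'r::{ring, monoid_mult}. \<forall>s t. entry E F s t f = 0}"
  proof (rule image_lpa_relations_subset, unfold mem_Collect_eq; intro allI)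
    fix v i j s t
    assume v: "v \<in> verts E" "out_arcs E v \<noteq> {}"
      and ij: "i \<in> {1..vertex_weight E \<omega> v}" "j \<in> {1..vertex_weight E \<omega> v}"
    have fin: "finite (out_arcs E v)" using row_finite v by (simp add: row_finite_def)
    have "entry E F s t (\<Sum>\<alpha>\<in>out_arcs E v. ed \<omega> \<alpha> i * gh \<omega> \<alpha> j) =
      (\<Sum>\<alpha>\<in>out_arcs E v. if (i = j \<and> s = t \<and> fst s = v) \<and> i \<le> \<omega> \<alpha> \<and> snd s \<in> Domain (F \<alpha> i) then 1 else 0 :: 'r)"
      unfolding entry_sum
    proof (rule sum.cong)
      fix \<alpha> assume \<alpha>: "\<alpha> \<in> out_arcs E v"
      show "entry E F s t (ed \<omega> \<alpha> i * gh \<omega> \<alpha> j) =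
        (if (i = j \<and> s = t \<and> fst s = v) \<and> i \<le> \<omega> \<alpha> \<and> snd s \<in> Domain (F \<alpha> i) then 1 else 0 :: 'r)"
        using \<alpha> ij edge_ghost[of \<alpha> i j s t]
        by (auto simp: ed_def gh_def mult_single plus_list_def entry_single simp del: letter_rel.simps)
    qed simp
    also have "\<dots> = (if i = j \<and> s = t \<and> fst s = v then 1 else 0)"
    proof (cases "i = j \<and> s = t \<and> fst s = v")
      case True
      then show ?thesis using sum_if_ex1[where 'r = 'r, OF fin row[OF v ij(1), of "snd s"]] by simp
    qed (simp only: simp_thms if_False sum.neutral_const)
    also have "\<dots> = entry E F s t (if i = j then vx v else 0 :: ('a, 'b) letter list \<Rightarrow>\<^sub>0 'r)"
      by (cases s; cases t) (auto simp: vx_def entry_single)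
    finally show "entry E F s t ((\<Sum>\<alpha>\<in>out_arcs E v. ed \<omega> \<alpha> i * gh \<omega> \<alpha> j) -
        (if i = j then vx v else 0)) = (0 :: 'r)"
      by (simp add: entry_diff)
  next
    fix \<alpha> \<beta> s t assume \<alpha>\<beta>: "\<alpha> \<in> arcs E" "\<beta> \<in> arcs E"
    have "entry E F s t (\<Sum>i = 1..max (\<omega> \<alpha>) (\<omega> \<beta>). gh \<omega> \<alpha> i * ed \<omega> \<beta> i) =
      (\<Sum>i = 1..max (\<omega> \<alpha>) (\<omega> \<beta>). if (\<alpha> = \<beta> \<and> s = t \<and> fst s = head E \<alpha>) \<and> i \<le> \<omega> \<alpha> \<and> snd s \<in> Range (F \<alpha> i) then 1 else 0 :: 'r)"
      unfolding entry_sum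
    proof (rule sum.cong)
      fix i assume i: "i \<in> {1..max (\<omega> \<alpha>) (\<omega> \<beta>)}"
      show "entry E F s t (gh \<omega> \<alpha> i * ed \<omega> \<beta> i) =
        (if (\<alpha> = \<beta> \<and> s = t \<and> fst s = head E \<alpha>) \<and> i \<le> \<omega> \<alpha> \<and> snd s \<in> Range (F \<alpha> i) then 1 else 0 :: 'r)"
        using \<alpha>\<beta> i ghost_edge[of \<alpha> \<beta> i s t]
        by (auto simp: ed_def gh_def mult_single plus_list_def entry_single simp del: letter_rel.simps)
    qed simp
    also have "\<dots> = (if \<alpha> = \<beta> \<and> s = t \<and> fst s = head E \<alpha> then 1 else 0)"
    proof (cases "\<alpha> = \<beta> \<and> s = t \<and> fst s = head E \<alpha>")
      case True
      have "\<exists>!i. i \<in> {1..\<omega> \<alpha>} \<and> i \<le> \<omega> \<alpha> \<and> snd s \<in> Range (F \<alpha> i)"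
        using column[OF \<alpha>\<beta>(1), of "snd s"] by auto
      from sum_if_ex1[where 'r = 'r, OF _ this] True show ?thesis by simp
    qed (simp only: simp_thms if_False sum.neutral_const)
    also have "\<dots> = entry E F s t (if \<alpha> = \<beta> then vx (head E \<alpha>) else 0 :: ('a, 'b) letter list \<Rightarrow>\<^sub>0 'r)"
      by (cases s; cases t) (auto simp: vx_def entry_single)
    finally show "entry E F s t ((\<Sum>i = 1..max (\<omega> \<alpha>) (\<omega> \<beta>). gh \<omega> \<alpha> i * ed \<omega> \<beta> i) -
        (if \<alpha> = \<beta> then vx (head E \<alpha>) else 0)) = (0 :: 'r)"
      by (simp add: entry_diff)
  qed (auto simp: vx_def ed_def gh_def mult_single plus_list_def entry_single entry_diff relcomp_unfold)
  then show "lpa_relations E \<omega> \<subseteq> (kernel :: (('a, 'b) letter list \<Rightarrow>\<^sub>0 'r) set)"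
    using lpa_relations_support[of \<omega>] unfolding kernel_def by auto
qed

text \<open>Simplicity makes the ideal of relations maximal. The annihilator contains it and is
  proper because \<open>v\<close> acts with an entry \<open>1\<close>; hence the representation is
  faithful.\<close>

lemma gen_ideal_eq_kernel:
  assumes simple: "simple_rng (weighted_lpa TYPE('r::{ring, monoid_mult}) E \<omega>)"
    and v: "v \<in> verts E"
  shows "(1 :: 'r) \<noteq> 0"
    and "gen_ideal (letters E \<omega>) (lpa_relations E \<omega> :: (('a, 'b) letter list \<Rightarrow>\<^sub>0 'r) set) = kernel"
proof -
  let ?I = "gen_ideal (letters E \<omega>) (lpa_relations E \<omega> :: (('a, 'b) letter list \<Rightarrow>\<^sub>0 'r) set)"
  interpret I: free_rng_ideal "letters E \<omega>" ?I
    by unfold_locales (rule gen_ideal_two_sided[OF lpa_relations_support])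
  have max: "?I \<noteq> nonempty_support (letters E \<omega>)"
    "\<And>J. two_sided_ideal J (free_rng (letters E \<omega>)) \<Longrightarrow> ?I \<subseteq> J \<Longrightarrow> J = ?I \<or> J = nonempty_support (letters E \<omega>)"
    using simple unfolding weighted_lpa_eq I.simple_quotient_iff by blast+
  show one: "(1 :: 'r) \<noteq> 0"
  proof
    assume "(1 :: 'r) = 0"
    \<comment> \<open>Over the zero ring the free ring would be zero, and so would its
      quotient.\<close>
    then have "r = 0" for r :: 'r by (metis mult_1_right mult_zero_right)
    then have "f = 0" for f :: "('a, 'b) letter list \<Rightarrow>\<^sub>0 'r" by (intro poly_mapping_eqI) simp
    then have "f \<in> ?I" for f using I.zero by metis
    then show False using max(1) I.subset by blast
  qed
  have "entry E F (v, 0) (v, 0) (vx v) = (1 :: 'r)" by (simp add: vx_def entry_single)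
  then have "vx v \<notin> (kernel :: (('a, 'b) letter list \<Rightarrow>\<^sub>0 'r) set)" 
    using one unfolding kernel_def mem_Collect_eq by metis
  then have "kernel \<noteq> (nonempty_support (letters E \<omega>) :: (('a, 'b) letter list \<Rightarrow>\<^sub>0 'r) set)"
    using vx_support[OF v] by blast
  moreover have "?I \<subseteq> kernel"
    by (intro gen_ideal_least kernel_two_sided kernel_scalar relations_subset_kernel)
  ultimately show "?I = kernel" using max(2)[OF kernel_two_sided] by blast
qed

text \<open>The left side does not mention \<open>F\<close>; this makes the vanishing of words
  comparable between branching systems.\<close>

lemma word_in_gen_ideal_iff:
  assumes simple: "simple_rng (weighted_lpa TYPE('r::{ring, monoid_mult}) E \<omega>)"
    and v: "v \<in> verts E" and w: "w \<in> lists (letters E \<omega>)" "w \<noteq> []"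
  shows "Poly_Mapping.single w 1 \<in> gen_ideal (letters E \<omega>) (lpa_relations E \<omega> :: (('a, 'b) letter list \<Rightarrow>\<^sub>0 'r) set)
    \<longleftrightarrow> word_rel E F w = {}"
  unfolding gen_ideal_eq_kernel(2)[OF simple v] kernel_def
  using gen_ideal_eq_kernel(1)[OF simple v] support_single[OF w] by (auto simp: entry_single)

end

section \<open>Construction of branching systems\<close>

text \<open>Pairs the elements that have equal positions in enumerations of the two sets.\<close>

lemma infinite_matching:
  fixes A B :: "nat set"
  assumes "infinite A" "infinite B"
  obtains f where "single_valued f" "single_valued (f\<inverse>)" "Domain f = A" "Range f = B"
proof -
  let ?a = "to_nat_on A" and ?b = "to_nat_on B"
  have a: "bij_betw ?a A UNIV" and b: "bij_betw ?b B UNIV"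
    using assms by (auto intro: to_nat_on_infinite)
  define f where "f = {(n, m). n \<in> A \<and> m \<in> B \<and> ?a n = ?b m}"
  show thesis
  proof (rule that[of f])
    have "y = z" if "(x, y) \<in> f" "(x, z) \<in> f" for x y z
      by (rule inj_onD[OF bij_betw_imp_inj_on[OF b]]) (use that in \<open>auto simp: f_def\<close>)
    then show "single_valued f" by (auto simp: single_valued_def)
    have "y = z" if "(y, x) \<in> f" "(z, x) \<in> f" for x y z
      by (rule inj_onD[OF bij_betw_imp_inj_on[OF a]]) (use that in \<open>auto simp: f_def\<close>)
    then show "single_valued (f\<inverse>)" by (auto simp: single_valued_def)
    have "\<exists>m\<in>B. ?a n = ?b m" for n using b by (metis UNIV_I bij_betw_imp_surj_on imageE)
    then show "Domain f = A" by (auto simp: f_def)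
    have "\<exists>n\<in>A. ?a n = ?b m" for m using a by (metis UNIV_I bij_betw_imp_surj_on imageE)
    then show "Range f = B" by (auto simp: f_def)
  qed
qed

text \<open>Matches \<open>A\<close> with \<open>B\<close> and the complements with each
  other.\<close>

lemma permutation_mapping:
  fixes A B :: "nat set"
  assumes "infinite A" "infinite (- A)" "infinite B" "infinite (- B)"
  obtains f where "single_valued f" "single_valued (f\<inverse>)" "Domain f = UNIV" "Range f = UNIV" "f `` A = B"
proof -
  obtain g where g: "single_valued g" "single_valued (g\<inverse>)" "Domain g = A" "Range g = B"
    using infinite_matching assms(1,3) by metis
  obtain h where h: "single_valued h" "single_valued (h\<inverse>)" "Domain h = - A" "Range h = - B"
    using infinite_matching assms(2,4) by metis
  have gd: "n \<in> A" "m \<in> B" if "(n, m) \<in> g" for n m using g that by blast+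
  have hd: "n \<notin> A" "m \<notin> B" if "(n, m) \<in> h" for n m using h that by blast+
  show thesis
  proof (rule that[of "g \<union> h"])
    show "single_valued (g \<union> h)"
      using g(1) h(1) gd hd unfolding single_valued_def by blast
    show "single_valued ((g \<union> h)\<inverse>)"
      using g(2) h(2) gd hd unfolding single_valued_def by blast
    show "Domain (g \<union> h) = UNIV" "Range (g \<union> h) = UNIV" using g h by auto
    have "g `` A = B" using g by blast
    moreover have "h `` A = {}" using hd by blast
    ultimately show "(g \<union> h) `` A = B" by blast
  qed
qed

text \<open>The residue modulo \<open>card A\<close> selects the element.\<close>

lemma infinite_fibres:
  assumes "finite A" "A \<noteq> {}"
  obtains g :: "nat \<Rightarrow> 'a" where "\<forall>n. g n \<in> A" "\<forall>a\<in>A. infinite {n. g n = a}"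
proof -
  obtain h where h: "bij_betw h {0..<card A} A" using assms(1) ex_bij_betw_nat_finite by blast
  have pos: "0 < card A" using assms by (simp add: card_gt_0_iff)
  show thesis
  proof (rule that[of "\<lambda>n. h (n mod card A)"])
    show "\<forall>n. h (n mod card A) \<in> A" using h pos by (auto simp: bij_betw_def)
    show "\<forall>a\<in>A. infinite {n. h (n mod card A) = a}"
    proof
    fix a assume "a \<in> A"
    then have "a \<in> h ` {0..<card A}" using h by (simp add: bij_betw_def)
    then obtain k where k: "k < card A" "h k = a" by auto
    have "inj (\<lambda>m. k + card A * m)" using pos by (auto simp: inj_on_def)
    then have "infinite (range (\<lambda>m. k + card A * m))" by (rule range_inj_infinite)
    moreover have "range (\<lambda>m. k + card A * m) \<subseteq> {n. h (n mod card A) = a}" using k by auto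
    ultimately show "infinite {n. h (n mod card A) = a}" by (rule infinite_super[rotated])
    qed
  qed
qed

text \<open>\<open>P\<close> marks the cells of the array that are to be nonempty; marking some cell
  in every row and in every column suffices. Each row splits \<open>\<nat>\<close> into infinite
  domains and each column into infinite ranges, one for every marked cell, and the piece in a cell
  matches its domain with its range.\<close>

lemma branching_at_exists:
  assumes fin: "finite (out_arcs E v)"
    and rows: "\<And>i. i \<in> {1..vertex_weight E \<omega> v} \<Longrightarrow> \<exists>\<alpha>\<in>out_arcs E v. i \<le> \<omega> \<alpha> \<and> P \<alpha> i"
    and columns: "\<And>\<alpha>. \<alpha> \<in> out_arcs E v \<Longrightarrow> \<exists>i\<in>{1..\<omega> \<alpha>}. P \<alpha> i"
  shows "\<exists>F. branching_at E \<omega> F v \<and>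
    (\<forall>\<alpha>\<in>out_arcs E v. \<forall>i\<in>{1..\<omega> \<alpha>}.
       if P \<alpha> i then infinite (Domain (F \<alpha> i)) \<and> infinite (Range (F \<alpha> i)) else F \<alpha> i = {})"
proof -
  let ?row = "\<lambda>i. {\<alpha> \<in> out_arcs E v. i \<le> \<omega> \<alpha> \<and> P \<alpha> i}"
  let ?col = "\<lambda>\<alpha>. {i \<in> {1..\<omega> \<alpha>}. P \<alpha> i}"
  have "\<exists>g. (\<forall>n. g n \<in> ?row i) \<and> (\<forall>\<alpha>\<in>?row i. infinite {n :: nat. g n = \<alpha>})"
    if i: "i \<in> {1..vertex_weight E \<omega> v}" for i
  proof -
    have "finite (?row i)" by (rule finite_subset[OF _ fin]) auto
    moreover have "?row i \<noteq> {}" using rows[OF i] by auto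
    ultimately obtain g :: "nat \<Rightarrow> _" where "\<forall>n. g n \<in> ?row i" "\<forall>\<alpha>\<in>?row i. infinite {n. g n = \<alpha>}"
      by (rule infinite_fibres)
    then show ?thesis by blast
  qed
  then have "\<forall>i\<in>{1..vertex_weight E \<omega> v}. \<exists>g.
      (\<forall>n. g n \<in> ?row i) \<and> (\<forall>\<alpha>\<in>?row i. infinite {n :: nat. g n = \<alpha>})" ..
  \<comment> \<open>\<open>g i n\<close> is the edge whose piece in row \<open>i\<close> will be
    defined at \<open>n\<close>.\<close>
  from bchoice[OF this] obtain g where g': "\<forall>i\<in>{1..vertex_weight E \<omega> v}.
      (\<forall>n. g i n \<in> ?row i) \<and> (\<forall>\<alpha>\<in>?row i. infinite {n :: nat. g i n = \<alpha>})"
    by (rule exE)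
  note g = bspec[OF g']
  have "\<exists>h. (\<forall>n. h n \<in> ?col \<alpha>) \<and> (\<forall>i\<in>?col \<alpha>. infinite {n :: nat. h n = i})"
    if \<alpha>: "\<alpha> \<in> out_arcs E v" for \<alpha>
  proof -
    have "finite (?col \<alpha>)" "?col \<alpha> \<noteq> {}" using columns[OF \<alpha>] by auto
    then obtain h :: "nat \<Rightarrow> nat" where "\<forall>n. h n \<in> ?col \<alpha>" "\<forall>i\<in>?col \<alpha>. infinite {n. h n = i}"
      by (rule infinite_fibres)
    then show ?thesis by blast
  qed
  then have "\<forall>\<alpha>\<in>out_arcs E v. \<exists>h.
      (\<forall>n. h n \<in> ?col \<alpha>) \<and> (\<forall>i\<in>?col \<alpha>. infinite {n :: nat. h n = i})" ..
  \<comment> \<open>\<open>h \<alpha> m\<close> is the index of the piece in column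
    \<open>\<alpha>\<close> that will have \<open>m\<close> in its range.\<close>
  from bchoice[OF this] obtain h where h': "\<forall>\<alpha>\<in>out_arcs E v.
      (\<forall>n. h \<alpha> n \<in> ?col \<alpha>) \<and> (\<forall>i\<in>?col \<alpha>. infinite {n :: nat. h \<alpha> n = i})"
    by (rule exE)
  note h = bspec[OF h']
  have le: "\<omega> \<alpha> \<le> vertex_weight E \<omega> v" if "\<alpha> \<in> out_arcs E v" for \<alpha>
    unfolding vertex_weight_def using fin that by (intro Max_ge) auto
  \<comment> \<open>Nothing is required outside the array, so that \<open>F\<close> can be chosen
    for all \<open>\<alpha>\<close> and \<open>i\<close> at once.\<close>
  define Q where "Q = (\<lambda>\<alpha> i f. \<alpha> \<in> out_arcs E v \<and> i \<in> {1..\<omega> \<alpha>} \<longrightarrow>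
      single_valued f \<and> single_valued (f\<inverse>) \<and>
      (if P \<alpha> i then Domain f = {n. g i n = \<alpha>} \<and> Range f = {m. h \<alpha> m = i} else f = {}))"
  have "\<exists>f. Q \<alpha> i f" for \<alpha> i
  proof (cases "\<alpha> \<in> out_arcs E v \<and> i \<in> {1..\<omega> \<alpha>} \<and> P \<alpha> i")
    case True
    then have "infinite {n. g i n = \<alpha>}" "infinite {m. h \<alpha> m = i}"
      using g[of i] h[of \<alpha>] le[of \<alpha>] by auto
    then obtain f where "single_valued f" "single_valued (f\<inverse>)" "Domain f = {n. g i n = \<alpha>}" "Range f = {m. h \<alpha> m = i}"
      by (rule infinite_matching)
    then show ?thesis using True by (auto simp: Q_def)
  next
    case False
    then show ?thesis by (intro exI[of _ "{}"]) (auto simp: Q_def single_valued_def)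
  qed
  then obtain F where "\<And>\<alpha> i. Q \<alpha> i (F \<alpha> i)" by metis
  then have F: "single_valued (F \<alpha> i) \<and> single_valued ((F \<alpha> i)\<inverse>) \<and>
      (if P \<alpha> i then Domain (F \<alpha> i) = {n. g i n = \<alpha>} \<and> Range (F \<alpha> i) = {m. h \<alpha> m = i} else F \<alpha> i = {})"
    if "\<alpha> \<in> out_arcs E v" "i \<in> {1..\<omega> \<alpha>}" for \<alpha> i
    using that unfolding Q_def by blast
  have dom: "n \<in> Domain (F \<alpha> i) \<longleftrightarrow> g i n = \<alpha>" if "\<alpha> \<in> out_arcs E v" "i \<in> {1..\<omega> \<alpha>}" for \<alpha> i n
  proof (cases "P \<alpha> i")
    case True
    then show ?thesis using F[OF that] by auto
  next
    \<comment> \<open>\<open>g\<close> selects only marked cells, so both sides are false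
      here.\<close>
    case False
    have "i \<in> {1..vertex_weight E \<omega> v}" using that le[of \<alpha>] by auto
    then have "g i n \<in> ?row i" using g by blast
    then show ?thesis using F[OF that] False by auto
  qed
  have ran: "m \<in> Range (F \<alpha> i) \<longleftrightarrow> h \<alpha> m = i" if "\<alpha> \<in> out_arcs E v" "i \<in> {1..\<omega> \<alpha>}" for \<alpha> i m
  proof (cases "P \<alpha> i")
    case True
    then show ?thesis using F[OF that] by auto
  next
    case False
    have "h \<alpha> m \<in> ?col \<alpha>" using h that by blast
    then show ?thesis using F[OF that] False by auto
  qed
  have "branching_at E \<omega> F v"
    unfolding branching_at_def
  proof (intro conjI ballI allI)
    fix i n assume i: "i \<in> {1..vertex_weight E \<omega> v}"
    then have gi: "g i n \<in> ?row i" using g by blast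
    show "\<exists>!\<alpha>. \<alpha> \<in> out_arcs E v \<and> i \<le> \<omega> \<alpha> \<and> n \<in> Domain (F \<alpha> i)"
    proof (rule ex1I[of _ "g i n"])
      show "g i n \<in> out_arcs E v \<and> i \<le> \<omega> (g i n) \<and> n \<in> Domain (F (g i n) i)"
        using gi i dom[of "g i n" i n] by auto
      show "\<alpha> = g i n" if "\<alpha> \<in> out_arcs E v \<and> i \<le> \<omega> \<alpha> \<and> n \<in> Domain (F \<alpha> i)" for \<alpha>
        using that i dom[of \<alpha> i n] by auto
    qed
  next
    fix \<alpha> m assume \<alpha>: "\<alpha> \<in> out_arcs E v"
    then have hm: "h \<alpha> m \<in> ?col \<alpha>" using h by blast
    show "\<exists>!i. i \<in> {1..\<omega> \<alpha>} \<and> m \<in> Range (F \<alpha> i)"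
    proof (rule ex1I[of _ "h \<alpha> m"])
      show "h \<alpha> m \<in> {1..\<omega> \<alpha>} \<and> m \<in> Range (F \<alpha> (h \<alpha> m))"
        using hm ran[OF \<alpha>, of "h \<alpha> m" m] by auto
      show "i = h \<alpha> m" if "i \<in> {1..\<omega> \<alpha>} \<and> m \<in> Range (F \<alpha> i)" for i
        using that ran[OF \<alpha>, of i m] by auto
    qed
  qed (use F in auto)
  moreover have "if P \<alpha> i then infinite (Domain (F \<alpha> i)) \<and> infinite (Range (F \<alpha> i)) else F \<alpha> i = {}"
    if "\<alpha> \<in> out_arcs E v" "i \<in> {1..\<omega> \<alpha>}" for \<alpha> i
    using F[OF that] g[of i] h[OF that(1)] le[OF that(1)] that by auto
  ultimately show ?thesis by blast
qed

lemma branching_at_cong: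
  assumes "\<And>\<alpha>. \<alpha> \<in> out_arcs E v \<Longrightarrow> F \<alpha> = G \<alpha>"
  shows "branching_at E \<omega> F v \<longleftrightarrow> branching_at E \<omega> G v"
proof -
  have "(\<alpha> \<in> out_arcs E v \<and> i \<le> \<omega> \<alpha> \<and> n \<in> Domain (F \<alpha> i)) = (\<alpha> \<in> out_arcs E v \<and> i \<le> \<omega> \<alpha> \<and> n \<in> Domain (G \<alpha> i))"
    for \<alpha> i n using assms by auto
  then show ?thesis using assms by (simp add: branching_at_def)
qed

lemma (in weighted_graph) branching_system_exists:
  assumes row_finite: "row_finite E"
    and rows: "\<And>v i. v \<in> verts E \<Longrightarrow> out_arcs E v \<noteq> {} \<Longrightarrow> i \<in> {1..vertex_weight E \<omega> v} \<Longrightarrow>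
      \<exists>\<alpha>\<in>out_arcs E v. i \<le> \<omega> \<alpha> \<and> P \<alpha> i"
    and columns: "\<And>\<alpha>. \<alpha> \<in> arcs E \<Longrightarrow> \<exists>i\<in>{1..\<omega> \<alpha>}. P \<alpha> i"
  obtains F where "branching_system E \<omega> F"
    "\<And>\<alpha> i. \<alpha> \<in> arcs E \<Longrightarrow> i \<in> {1..\<omega> \<alpha>} \<Longrightarrow>
       if P \<alpha> i then infinite (Domain (F \<alpha> i)) \<and> infinite (Range (F \<alpha> i)) else F \<alpha> i = {}"
proof -
  define Q where "Q = (\<lambda>v F. branching_at E \<omega> F v \<and> (\<forall>\<alpha>\<in>out_arcs E v. \<forall>i\<in>{1..\<omega> \<alpha>}.
     if P \<alpha> i then infinite (Domain (F \<alpha> i)) \<and> infinite (Range (F \<alpha> i)) else F \<alpha> i = {}))"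
  have "\<exists>F. Q v F" if v: "v \<in> verts E" "out_arcs E v \<noteq> {}" for v
    unfolding Q_def
    using v row_finite
    by (intro branching_at_exists rows[OF v] columns) (auto simp: row_finite_def)
  then have "\<forall>v\<in>{v \<in> verts E. out_arcs E v \<noteq> {}}. \<exists>F. Q v F" by blast
  from bchoice[OF this] obtain G where "\<forall>v\<in>{v \<in> verts E. out_arcs E v \<noteq> {}}. Q v (G v)" by (rule exE)
  then have G: "branching_at E \<omega> (G v) v \<and> (\<forall>\<alpha>\<in>out_arcs E v. \<forall>i\<in>{1..\<omega> \<alpha>}.
     if P \<alpha> i then infinite (Domain (G v \<alpha> i)) \<and> infinite (Range (G v \<alpha> i)) else G v \<alpha> i = {})"
    if "v \<in> verts E" "out_arcs E v \<noteq> {}" for v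
    using that unfolding Q_def by blast
  \<comment> \<open>Every edge belongs to the array of one vertex only, so the local choices
    glue.\<close>
  let ?F = "\<lambda>\<alpha>. G (tail E \<alpha>) \<alpha>"
  show thesis
  proof (rule that[of ?F])
    have "branching_at E \<omega> ?F v" if v: "v \<in> verts E" "out_arcs E v \<noteq> {}" for v
      using branching_at_cong[of E v ?F "G v"] G[OF v] by auto
    then show "branching_system E \<omega> ?F" by (simp add: branching_system_def)
    fix \<alpha> i assume \<alpha>: "\<alpha> \<in> arcs E" "i \<in> {1..\<omega> \<alpha>}"
    then have "tail E \<alpha> \<in> verts E" "out_arcs E (tail E \<alpha>) \<noteq> {}" "\<alpha> \<in> out_arcs E (tail E \<alpha>)" by auto
    then show "if P \<alpha> i then infinite (Domain (?F \<alpha> i)) \<and> infinite (Range (?F \<alpha> i)) else ?F \<alpha> i = {}"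
      using G \<alpha> by blast
  qed
qed

text \<open>Composing all pieces in one column with a permutation keeps the domains, hence the rows,
  and only permutes the partition into ranges.\<close>

lemma (in branching_graph) twist:
  assumes \<pi>: "single_valued \<pi>" "single_valued (\<pi>\<inverse>)" "Domain \<pi> = UNIV" "Range \<pi> = UNIV"
  shows "branching_system E \<omega> (F(\<delta> := \<lambda>i. F \<delta> i O \<pi>))"
proof -
  let ?G = "F(\<delta> := \<lambda>i. F \<delta> i O \<pi>)"
  have dom: "n \<in> Domain (?G \<alpha> i) \<longleftrightarrow> n \<in> Domain (F \<alpha> i)" for \<alpha> i n
    using \<pi>(3) by (cases "\<alpha> = \<delta>") (auto simp: Domain_iff relcomp_unfold, blast)
  have "branching_at E \<omega> ?G v" if v: "v \<in> verts E" "out_arcs E v \<noteq> {}" for v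
    unfolding branching_at_def dom
  proof (intro conjI ballI allI)
    fix \<alpha> i assume "\<alpha> \<in> out_arcs E v" "i \<in> {1..\<omega> \<alpha>}"
    then show "single_valued (?G \<alpha> i)" "single_valued ((?G \<alpha> i)\<inverse>)"
      using injective[of \<alpha> i] \<pi> by (auto simp: converse_relcomp intro: single_valued_relcomp)
  next
    fix \<alpha> m assume \<alpha>: "\<alpha> \<in> out_arcs E v"
    obtain n where n: "(n, m) \<in> \<pi>" using \<pi>(4) by blast
    have "m \<in> Range (F \<delta> i O \<pi>) \<longleftrightarrow> n \<in> Range (F \<delta> i)" for i
      using n \<pi>(2) by (auto dest: single_valuedD)
    \<comment> \<open>One \<open>k\<close> serves all \<open>i\<close>: the preimage
      \<open>n\<close> of \<open>m\<close> if \<open>\<alpha> = \<delta>\<close>, and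
      \<open>m\<close> otherwise.\<close>
    then have "\<exists>k. \<forall>i. m \<in> Range (?G \<alpha> i) \<longleftrightarrow> k \<in> Range (F \<alpha> i)"
      by (cases "\<alpha> = \<delta>") auto
    then obtain k where k: "\<And>i. m \<in> Range (?G \<alpha> i) \<longleftrightarrow> k \<in> Range (F \<alpha> i)" by blast
    show "\<exists>!i. i \<in> {1..\<omega> \<alpha>} \<and> m \<in> Range (?G \<alpha> i)"
      unfolding k using \<alpha> by (intro column) auto
  qed (use row[OF v] in auto)
  then show ?thesis by (simp add: branching_system_def)
qed

section \<open>Simple weighted Leavitt path algebras\<close>

lemma (in weighted_graph) word_rel_empty_transfer:
  assumes simple: "simple_rng (weighted_lpa TYPE('r::{ring, monoid_mult}) E \<omega>)"
    and "row_finite E" "branching_system E \<omega> F" "branching_system E \<omega> G" "v \<in> verts E"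
    and w: "w \<in> lists (letters E \<omega>)" "w \<noteq> []" "word_rel E F w = {}"
  shows "word_rel E G w = {}"
proof -
  interpret F: branching_graph E \<omega> F using assms by unfold_locales
  interpret G: branching_graph E \<omega> G using assms by unfold_locales
  show ?thesis
    using F.word_in_gen_ideal_iff[OF simple assms(5) w(1,2)] G.word_in_gen_ideal_iff[OF simple assms(5) w(1,2)] w(3)
    by simp
qed

section \<open>Adjoint words and changes of the branching system at one edge\<close>

primrec star :: "('v, 'e) letter \<Rightarrow> ('v, 'e) letter" where
  "star (Vertex v) = Vertex v"
| "star (Edge a) = Ghost a"
| "star (Ghost a) = Edge a"

lemma letter_rel_star: "letter_rel E F (star x) = (letter_rel E F x)\<inverse>"
proof (cases x)
  case (Edge a)
  then show ?thesis by (cases a) auto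
next
  case (Ghost a)
  then show ?thesis by (cases a) auto
qed auto

text \<open>Makes the domain of a word the range of its adjoint, so that \<open>hits\<close> can
  describe both.\<close>

lemma word_rel_star: "word_rel E F (rev (map star w)) = (word_rel E F w)\<inverse>"
  by (induction w) (simp_all add: word_rel_append letter_rel_star converse_relcomp)

lemma word_rel_cong:
  assumes "\<And>x. x \<in> set w \<Longrightarrow> letter_rel E F x = letter_rel E G x"
  shows "word_rel E F w = word_rel E G w"
  using assms by (induction w) auto

lemma letter_rel_upd:
  assumes "\<And>i. x \<noteq> Edge (\<delta>, i) \<and> x \<noteq> Ghost (\<delta>, i)"
  shows "letter_rel E (F(\<delta> := f)) x = letter_rel E F x"
proof (cases x)
  case (Edge a)
  then show ?thesis using assms by (cases a) auto
next
  case (Ghost a)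
  then show ?thesis using assms by (cases a) auto
qed simp

section \<open>Points hit by paths that start at weighted vertices\<close>

lemma finite_Image_single_valued:
  assumes "single_valued r" "finite A"
  shows "finite (r `` A)"
proof -
  have "finite (r `` {x})" for x
  proof (cases "\<exists>y. (x, y) \<in> r")
    case True
    then obtain y where "(x, y) \<in> r" by blast
    then have "r `` {x} \<subseteq> {y}" using assms(1) by (auto dest: single_valuedD)
    then show ?thesis by (rule finite_subset) simp
  next
    case False
    then have "r `` {x} = {}" by blast
    then show ?thesis by simp
  qed
  moreover have "r `` A = (\<Union>x\<in>A. r `` {x})" by blast
  ultimately show ?thesis using assms(2) by simp
qed

lemma infinite_Image:
  assumes "single_valued (r\<inverse>)" "Domain r = UNIV" "infinite A"
  shows "infinite (r `` A)"
proof
  assume "finite (r `` A)"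
  then have "finite (r\<inverse> `` (r `` A))" by (rule finite_Image_single_valued[OF assms(1)])
  moreover have "A \<subseteq> r\<inverse> `` (r `` A)" using assms(2) by blast
  ultimately show False using assms(3) finite_subset by blast
qed

text \<open>For empty \<open>B\<close> this is the weight forest. The forbidden edges
  \<open>B\<close> keep a path away from the edge at which a permutation is to be inserted.\<close>

inductive_set (in weighted_graph) reach :: "'e set \<Rightarrow> 'v set" for B where
  base: "v \<in> weighted_vertices E \<omega> \<Longrightarrow> v \<in> reach B"
| step: "\<alpha> \<in> arcs E \<Longrightarrow> \<alpha> \<notin> B \<Longrightarrow> tail E \<alpha> \<in> reach B \<Longrightarrow> head E \<alpha> \<in> reach B"

context weighted_graph
begin

lemma reach_subset_forest: "reach B \<subseteq> weight_forest E \<omega>"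
proof
  fix v assume "v \<in> reach B"
  then show "v \<in> weight_forest E \<omega>"
    by induction (use weighted_vertices_subset_forest forest_closed in auto)
qed

text \<open>The first edge of \<open>C\<close> on a path would start at a vertex reached without
  \<open>C\<close>, which the assumption excludes.\<close>

lemma reach_extend:
  assumes "\<And>\<alpha>. \<alpha> \<in> C \<Longrightarrow> tail E \<alpha> \<notin> reach (B \<union> C)"
  shows "reach B \<subseteq> reach (B \<union> C)"
proof
  fix v assume "v \<in> reach B"
  then show "v \<in> reach (B \<union> C)"
  proof induction
    case (step \<alpha>)
    then show ?case using assms[of \<alpha>] by (intro reach.step) auto
  qed (rule reach.base)
qed

text \<open>Under the assumption \<open>reach B\<close> is closed under all edges. The
  contrapositive yields a forbidden edge whose source is reached without forbidden edges.\<close>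

lemma forest_subset_reach:
  assumes "\<And>\<alpha>. \<alpha> \<in> B \<Longrightarrow> tail E \<alpha> \<notin> reach B"
  shows "weight_forest E \<omega> \<subseteq> reach B"
  using assms by (intro forest_least) (auto intro: reach.intros)

end

definition hits ::
    "('v, 'e) pre_digraph \<Rightarrow> ('e \<Rightarrow> nat \<Rightarrow> (nat \<times> nat) set) \<Rightarrow> ('v, 'e) letter list \<Rightarrow> 'v \<Rightarrow> nat set" where
  "hits E F w v = {n. (v, n) \<in> Range (word_rel E F w)}"

lemma hits_append_edge: "hits E F (w @ [Edge (\<alpha>, i)]) (head E \<alpha>) = F \<alpha> i `` hits E F w (tail E \<alpha>)"
  unfolding hits_def word_rel_append by auto

text \<open>With all pieces infinite, any second piece in a row or column shows that the first has a
  coinfinite domain or range.\<close>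

locale full_branching_graph = branching_graph +
  assumes full: "\<alpha> \<in> arcs E \<Longrightarrow> i \<in> {1..\<omega> \<alpha>} \<Longrightarrow> infinite (Domain (F \<alpha> i)) \<and> infinite (Range (F \<alpha> i))"
begin

text \<open>As the only edge at its source, \<open>\<alpha>\<close> has a total injective piece
  \<open>F \<alpha> 1\<close>, which preserves infinite sets and infinite complements. At a weighted
  vertex the range of \<open>F \<alpha> 2\<close> supplies the complement even if every point was
  hit.\<close>

lemma hits_step:
  assumes \<alpha>: "\<alpha> \<in> arcs E" "out_arcs E (tail E \<alpha>) = {\<alpha>}"
    and inf: "infinite (hits E F w (tail E \<alpha>))"
    and coinf: "infinite (- hits E F w (tail E \<alpha>)) \<or> tail E \<alpha> \<in> weighted_vertices E \<omega>"
  shows "infinite (hits E F (w @ [Edge (\<alpha>, 1)]) (head E \<alpha>))"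
    and "infinite (- hits E F (w @ [Edge (\<alpha>, 1)]) (head E \<alpha>))"
proof -
  let ?A = "hits E F w (tail E \<alpha>)"
  have one: "1 \<in> {1..\<omega> \<alpha>}" using weight_pos[OF \<alpha>(1)] by simp
  have sv: "single_valued ((F \<alpha> 1)\<inverse>)" by (rule injective[OF \<alpha>(1) one])
  have weight: "vertex_weight E \<omega> (tail E \<alpha>) = \<omega> \<alpha>" using \<alpha>(2) by (simp add: vertex_weight_def)
  have "n \<in> Domain (F \<alpha> 1)" for n
    using row[of "tail E \<alpha>" 1 n] one \<alpha> weight by auto
  then have dom: "Domain (F \<alpha> 1) = UNIV" by blast
  show "infinite (hits E F (w @ [Edge (\<alpha>, 1)]) (head E \<alpha>))"
    unfolding hits_append_edge by (rule infinite_Image[OF sv dom inf])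
  from coinf show "infinite (- hits E F (w @ [Edge (\<alpha>, 1)]) (head E \<alpha>))"
    unfolding hits_append_edge
  proof
    assume "infinite (- ?A)"
    then have "infinite (F \<alpha> 1 `` (- ?A))" by (rule infinite_Image[OF sv dom])
    moreover have "F \<alpha> 1 `` (- ?A) \<subseteq> - (F \<alpha> 1 `` ?A)" using sv by (auto dest: single_valuedD)
    ultimately show "infinite (- (F \<alpha> 1 `` ?A))" by (rule infinite_super[rotated])
  next
    assume "tail E \<alpha> \<in> weighted_vertices E \<omega>"
    then have two: "2 \<in> {1..\<omega> \<alpha>}" using weight by (simp add: weighted_vertices_def)
    then have "infinite (Range (F \<alpha> 2))" using full[OF \<alpha>(1)] by blast
    moreover have "Range (F \<alpha> 2) \<subseteq> - (F \<alpha> 1 `` ?A)"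
      using column_unique[OF \<alpha>(1) one two] by fastforce
    ultimately show "infinite (- (F \<alpha> 1 `` ?A))" by (rule infinite_super[rotated])
  qed
qed

text \<open>Induction along the path by \<open>hits_step\<close>. The empty word hits every point
  over its weighted starting vertex, hence the exception for weighted vertices.\<close>

lemma path_word:
  assumes "v \<in> reach B"
    and single: "\<And>\<alpha>. \<alpha> \<in> arcs E \<Longrightarrow> \<alpha> \<notin> B \<Longrightarrow> tail E \<alpha> \<in> weight_forest E \<omega> \<Longrightarrow> out_arcs E (tail E \<alpha>) = {\<alpha>}"
  shows "\<exists>w. set w \<subseteq> {Edge (\<alpha>, 1) | \<alpha>. \<alpha> \<in> arcs E \<and> \<alpha> \<notin> B} \<and> infinite (hits E F w v) \<and>
    (infinite (- hits E F w v) \<or> v \<in> weighted_vertices E \<omega>)"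
  using assms(1)
proof induction
  case (base v)
  then show ?case by (intro exI[of _ "[]"]) (simp add: hits_def)
next
  case (step \<alpha>)
  then obtain w where w: "set w \<subseteq> {Edge (\<alpha>, 1) | \<alpha>. \<alpha> \<in> arcs E \<and> \<alpha> \<notin> B}"
    "infinite (hits E F w (tail E \<alpha>))"
    "infinite (- hits E F w (tail E \<alpha>)) \<or> tail E \<alpha> \<in> weighted_vertices E \<omega>"
    by blast
  have "out_arcs E (tail E \<alpha>) = {\<alpha>}" using step reach_subset_forest by (intro single) auto
  from hits_step[OF step(1) this w(2,3)] w(1) step(1,2) show ?case
    by (intro exI[of _ "w @ [Edge (\<alpha>, 1)]"]) auto
qed

text \<open>The step through \<open>\<delta>\<close> removes the exception for weighted vertices.
  Since \<open>\<delta>\<close> may lie in \<open>B\<close>, the word \<open>w\<close> before it can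
  be made to avoid it.\<close>

lemma path_word_through:
  assumes \<delta>: "\<delta> \<in> arcs E" "tail E \<delta> \<in> reach B" "out_arcs E (tail E \<delta>) = {\<delta>}"
    and single: "\<forall>\<alpha>\<in>arcs E. \<alpha> \<notin> B \<longrightarrow> tail E \<alpha> \<in> weight_forest E \<omega> \<longrightarrow> out_arcs E (tail E \<alpha>) = {\<alpha>}"
  shows "\<exists>w. set w \<subseteq> {Edge (\<alpha>, 1) | \<alpha>. \<alpha> \<in> arcs E \<and> \<alpha> \<notin> B} \<and>
    infinite (hits E F (w @ [Edge (\<delta>, 1)]) (head E \<delta>)) \<and>
    infinite (- hits E F (w @ [Edge (\<delta>, 1)]) (head E \<delta>))"
proof -
  obtain w where w: "set w \<subseteq> {Edge (\<alpha>, 1) | \<alpha>. \<alpha> \<in> arcs E \<and> \<alpha> \<notin> B}"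
    "infinite (hits E F w (tail E \<delta>))"
    "infinite (- hits E F w (tail E \<delta>)) \<or> tail E \<delta> \<in> weighted_vertices E \<omega>"
    using path_word[OF \<delta>(2)] single by blast
  show ?thesis using w(1) hits_step[OF \<delta>(1,3) w(2,3)] by blast
qed

end

text \<open>An edge of maximal weight meets every row of its array.\<close>

lemma (in weighted_graph) ex_full_branching_graph:
  assumes "row_finite E"
  obtains F where "full_branching_graph E \<omega> F"
proof -
  show thesis
  proof (rule branching_system_exists[OF assms, where P = "\<lambda>_ _. True"])
    fix v i assume v: "v \<in> verts E" "out_arcs E v \<noteq> {}" "i \<in> {1..vertex_weight E \<omega> v}"
    from assms v(1,2) obtain \<mu> where "\<mu> \<in> out_arcs E v" "\<omega> \<mu> = vertex_weight E \<omega> v"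
      by (rule ex_max_weight)
    then show "\<exists>\<alpha>\<in>out_arcs E v. i \<le> \<omega> \<alpha> \<and> True"
      using v(3) by (intro bexI[of _ \<mu>]) auto
  next
    show "\<exists>i\<in>{1..\<omega> \<alpha>}. True" if "\<alpha> \<in> arcs E" for \<alpha> using weight_pos[OF that] by auto
  next
    fix F assume F: "branching_system E \<omega> F" and "\<And>\<alpha> i. \<alpha> \<in> arcs E \<Longrightarrow> i \<in> {1..\<omega> \<alpha>} \<Longrightarrow>
      if True then infinite (Domain (F \<alpha> i)) \<and> infinite (Range (F \<alpha> i)) else F \<alpha> i = {}"
    then have "full_branching_graph E \<omega> F"
      using assms by unfold_locales (auto split: if_splits)
    then show thesis by (rule that)
  qed
qed

text \<open>
  What remains of simplicity: since the annihilators of all branching systems coincide, a word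
  that vanishes in one of them vanishes in all.
\<close>

locale rigid_graph = weighted_graph +
  assumes row_finite: "row_finite E"
    and rigid: "branching_system E \<omega> F \<Longrightarrow> branching_system E \<omega> G \<Longrightarrow> w \<in> lists (letters E \<omega>) \<Longrightarrow> w \<noteq> [] \<Longrightarrow>
      word_rel E F w = {} \<Longrightarrow> word_rel E G w = {}"
begin

section \<open>Edges that leave or enter vertices of the weight forest of a rigid graph\<close>

lemma edge_letter: "\<alpha> \<in> arcs E \<Longrightarrow> Edge (\<alpha>, 1) \<in> letters E \<omega>"
  using weight_pos by (auto simp: letters_def edges_def)

text \<open>With a second edge \<open>\<beta>'\<close> the cell of \<open>\<gamma>\<close> in row 1
  can be left empty: \<open>\<beta>'\<close> fills the row, index 2 fills the column. The word
  consisting of the edge \<open>(\<gamma>, 1)\<close> then vanishes, but not in a full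
  system.\<close>

lemma out_arcs_weighted:
  assumes v: "v \<in> weighted_vertices E \<omega>" and "\<alpha> \<in> out_arcs E v" "\<beta> \<in> out_arcs E v"
  shows "\<alpha> = \<beta>"
proof (rule ccontr)
  assume "\<alpha> \<noteq> \<beta>"
  have "v \<in> verts E" "out_arcs E v \<noteq> {}" using v by (auto simp: weighted_vertices_def)
  with row_finite obtain \<gamma> where \<gamma>: "\<gamma> \<in> out_arcs E v" "\<omega> \<gamma> = vertex_weight E \<omega> v"
    by (rule ex_max_weight)
  then have two: "2 \<le> \<omega> \<gamma>" using v by (simp add: weighted_vertices_def)
  obtain \<beta>' where \<beta>': "\<beta>' \<in> out_arcs E v" "\<beta>' \<noteq> \<gamma>" using assms(2,3) \<open>\<alpha> \<noteq> \<beta>\<close> by metis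
  let ?P = "\<lambda>\<delta> i. \<not> (\<delta> = \<gamma> \<and> i = (1::nat))"
  have vanish: "\<exists>F. branching_system E \<omega> F \<and> F \<gamma> 1 = {}"
  proof (rule branching_system_exists[OF row_finite, where P = ?P])
    fix u i assume u: "u \<in> verts E" "out_arcs E u \<noteq> {}" "i \<in> {1..vertex_weight E \<omega> u}"
    from row_finite u(1,2) obtain \<mu> where \<mu>: "\<mu> \<in> out_arcs E u" "\<omega> \<mu> = vertex_weight E \<omega> u"
      by (rule ex_max_weight)
    show "\<exists>\<alpha>\<in>out_arcs E u. i \<le> \<omega> \<alpha> \<and> ?P \<alpha> i"
    \<comment> \<open>The heaviest edge serves every row except at the emptied cell, where
      \<open>\<beta>'\<close> replaces it.\<close>
    proof (cases "\<mu> = \<gamma> \<and> i = 1")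
      case True
      then have "u = v" using \<mu>(1) \<gamma>(1) by simp
      have "i \<le> \<omega> \<beta>' \<and> ?P \<beta>' i" using True \<beta>' weight_pos[of \<beta>'] by simp
      then show ?thesis using \<beta>'(1) unfolding \<open>u = v\<close> by (rule bexI)
    next
      case False
      then show ?thesis using \<mu> u(3) by (intro bexI[of _ \<mu>]) auto
    qed
  next
    fix \<delta> assume \<delta>: "\<delta> \<in> arcs E"
    show "\<exists>i\<in>{1..\<omega> \<delta>}. ?P \<delta> i"
    proof (cases "\<delta> = \<gamma>")
      case True
      then show ?thesis using two by (intro bexI[of _ 2]) auto
    next
      case False
      then show ?thesis using weight_pos[OF \<delta>] by (intro bexI[of _ 1]) auto
    qed
  next
    fix F assume F: "branching_system E \<omega> F" and pattern: "\<And>\<alpha> i. \<alpha> \<in> arcs E \<Longrightarrow> i \<in> {1..\<omega> \<alpha>} \<Longrightarrow>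
       if ?P \<alpha> i then infinite (Domain (F \<alpha> i)) \<and> infinite (Range (F \<alpha> i)) else F \<alpha> i = {}"
    have "F \<gamma> 1 = {}" using pattern[of \<gamma> 1] \<gamma> two by simp
    then show ?thesis using F by blast
  qed
  then obtain F where F: "branching_system E \<omega> F" "F \<gamma> 1 = {}" by blast
  obtain G where "full_branching_graph E \<omega> G"
    using row_finite by (rule ex_full_branching_graph)
  then interpret G: full_branching_graph E \<omega> G .
  have "word_rel E G [Edge (\<gamma>, 1)] = {}"
  proof (rule rigid[OF F(1) G.branching])
    show "[Edge (\<gamma>, 1)] \<in> lists (letters E \<omega>)" using edge_letter[of \<gamma>] \<gamma>(1) by simp
    show "word_rel E F [Edge (\<gamma>, 1)] = {}" using F(2) by simp
  qed simp
  then have "G \<gamma> 1 = {}" by auto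
  then show False using G.full[of \<gamma> 1] \<gamma> two by auto
qed

text \<open>
  Composing \<open>F \<delta>\<close> with a permutation that maps the vertices hit by the word through \<open>\<delta>\<close>
  into or off the domain of \<open>w'\<close> makes \<open>w \<delta>\<^sub>1 w'\<close> vanish or not.
\<close>

lemma no_free_junction:
  assumes F: "branching_system E \<omega> F"
    and \<delta>: "\<delta> \<in> arcs E"
    and w: "w \<in> lists (letters E \<omega>)" "w' \<in> lists (letters E \<omega>)"
    and avoid: "\<And>i. Edge (\<delta>, i) \<notin> set (w @ w')" "\<And>i. Ghost (\<delta>, i) \<notin> set (w @ w')"
    and A: "infinite (hits E F (w @ [Edge (\<delta>, 1)]) (head E \<delta>))"
      "infinite (- hits E F (w @ [Edge (\<delta>, 1)]) (head E \<delta>))"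
    and D: "infinite (hits E F (rev (map star w')) (head E \<delta>))"
      "infinite (- hits E F (rev (map star w')) (head E \<delta>))"
  shows False
proof -
  interpret branching_graph E \<omega> F using row_finite F by unfold_locales
  define A where "A = hits E F (w @ [Edge (\<delta>, 1)]) (head E \<delta>)"
  define D where "D = hits E F (rev (map star w')) (head E \<delta>)"
  have D_eq: "D = {n. (head E \<delta>, n) \<in> Domain (word_rel E F w')}"
    by (simp add: D_def hits_def word_rel_star)
  define twisted where "twisted = (\<lambda>\<pi>. F(\<delta> := \<lambda>i. F \<delta> i O \<pi>))"
  \<comment> \<open>Since \<open>\<delta>\<close> occurs neither in \<open>w\<close> nor in
    \<open>w'\<close>, the twist is felt only at the junction.\<close>
  have same: "word_rel E (twisted \<pi>) w = word_rel E F w" "word_rel E (twisted \<pi>) w' = word_rel E F w'" for \<pi>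
    using avoid unfolding twisted_def by (auto intro!: word_rel_cong letter_rel_upd)
  have iff: "word_rel E (twisted \<pi>) (w @ [Edge (\<delta>, 1)] @ w') = {} \<longleftrightarrow> \<pi> `` A \<inter> D = {}" for \<pi>
  proof -
    have "A = F \<delta> 1 `` hits E F w (tail E \<delta>)" by (simp add: A_def hits_append_edge)
    then have "\<pi> `` A = (F \<delta> 1 O \<pi>) `` hits E F w (tail E \<delta>)" by blast
    moreover have "letter_rel E (twisted \<pi>) (Edge (\<delta>, 1)) =
        {((tail E \<delta>, n), (head E \<delta>, m)) | n m. (n, m) \<in> F \<delta> 1 O \<pi>}"
      by (simp add: twisted_def)
    ultimately show ?thesis
      unfolding word_rel_append word_rel.simps same D_eq hits_def by fastforce
  qed
  have AD: "infinite A" "infinite (- A)" "infinite D" "infinite (- D)" "infinite (- (- D))"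
    using A D by (simp_all add: A_def D_def)
  obtain \<pi> where \<pi>: "single_valued \<pi>" "single_valued (\<pi>\<inverse>)" "Domain \<pi> = UNIV" "Range \<pi> = UNIV" "\<pi> `` A = D"
    by (rule permutation_mapping[OF AD(1-4)])
  obtain \<rho> where \<rho>: "single_valued \<rho>" "single_valued (\<rho>\<inverse>)" "Domain \<rho> = UNIV" "Range \<rho> = UNIV" "\<rho> `` A = - D"
    by (rule permutation_mapping[OF AD(1,2,4,5)])
  have "D \<noteq> {}" using AD(3) by auto
  \<comment> \<open>\<open>\<rho>\<close> moves \<open>A\<close> off \<open>D\<close>, so the word
    vanishes; rigidity carries this over to \<open>\<pi>\<close>, which maps \<open>A\<close> onto
    the nonempty set \<open>D\<close>.\<close>
  have "word_rel E (twisted \<pi>) (w @ [Edge (\<delta>, 1)] @ w') = {}"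
  proof (rule rigid)
    show "branching_system E \<omega> (twisted \<rho>)" "branching_system E \<omega> (twisted \<pi>)"
      unfolding twisted_def by (rule twist; fact)+
    show "w @ [Edge (\<delta>, 1)] @ w' \<in> lists (letters E \<omega>)" using w edge_letter[OF \<delta>] by auto
    show "word_rel E (twisted \<rho>) (w @ [Edge (\<delta>, 1)] @ w') = {}" unfolding iff \<rho>(5) by blast
  qed simp
  then show False unfolding iff \<pi>(5) using \<open>D \<noteq> {}\<close> by blast
qed

lemma word_in_letters: "set w \<subseteq> {Edge (\<alpha>, 1) | \<alpha>. \<alpha> \<in> arcs E \<and> \<alpha> \<notin> B} \<Longrightarrow> w \<in> lists (letters E \<omega>)"
  using edge_letter by auto

text \<open>Otherwise a path from a weighted vertex leads to a first edge \<open>\<beta>\<close>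
  with a sibling. By \<open>out_arcs_weighted\<close> the source of \<open>\<beta>\<close> is not
  weighted, so the path has a last edge \<open>\<delta>\<close>, and \<open>no_free_junction\<close>
  applies there.\<close>

lemma out_arcs_forest:
  assumes \<alpha>: "\<alpha> \<in> arcs E" "tail E \<alpha> \<in> weight_forest E \<omega>"
  shows "out_arcs E (tail E \<alpha>) = {\<alpha>}"
proof (rule ccontr)
  assume "out_arcs E (tail E \<alpha>) \<noteq> {\<alpha>}"
  define B where "B = {\<beta> \<in> arcs E. out_arcs E (tail E \<beta>) \<noteq> {\<beta>}}"
  \<comment> \<open>Forbidding \<open>B\<close> makes \<open>\<beta>\<close> a first branching edge:
    the path to its source uses only edges without siblings.\<close>
  have "\<exists>\<beta>\<in>B. tail E \<beta> \<in> reach B"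
  proof (rule ccontr)
    assume none: "\<not> (\<exists>\<beta>\<in>B. tail E \<beta> \<in> reach B)"
    then have "weight_forest E \<omega> \<subseteq> reach B" by (intro forest_subset_reach) auto
    then have "tail E \<alpha> \<in> reach B" using \<alpha> by auto
    moreover have "\<alpha> \<in> B" using \<alpha> \<open>out_arcs E (tail E \<alpha>) \<noteq> {\<alpha>}\<close> by (simp add: B_def)
    ultimately show False using none by blast
  qed
  then obtain \<beta> where \<beta>: "\<beta> \<in> B" "tail E \<beta> \<in> reach B" by blast
  have "tail E \<beta> \<notin> weighted_vertices E \<omega>"
    using out_arcs_weighted[of "tail E \<beta>" _ \<beta>] \<beta>(1) by (auto simp: B_def)
  with \<beta>(2) obtain \<delta> where \<delta>: "\<delta> \<in> arcs E" "\<delta> \<notin> B" "tail E \<delta> \<in> reach B" "head E \<delta> = tail E \<beta>"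
    by (auto elim: reach.cases)
  \<comment> \<open>A path to the source of \<open>\<delta>\<close> can be cut at its first use of
    \<open>\<delta>\<close>: if the claim failed, \<open>reach_extend\<close> would prove
    it.\<close>
  have "tail E \<delta> \<in> reach (B \<union> {\<delta>})"
    using reach_extend[of "{\<delta>}" B] \<delta>(3) by auto
  have \<beta>': "\<beta> \<in> arcs E" "\<beta> \<noteq> \<delta>" using \<beta>(1) \<delta>(2) by (auto simp: B_def)
  have "\<beta> \<in> out_arcs E (tail E \<beta>)" "out_arcs E (tail E \<beta>) \<noteq> {\<beta>}" using \<beta>(1) by (auto simp: B_def)
  then obtain \<beta>2 where "\<beta>2 \<in> out_arcs E (tail E \<beta>)" "\<beta>2 \<noteq> \<beta>" by blast
  then have \<beta>2: "\<beta>2 \<in> arcs E" "tail E \<beta>2 = tail E \<beta>" "\<beta>2 \<noteq> \<beta>" by auto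
  obtain F where "full_branching_graph E \<omega> F"
    using row_finite by (rule ex_full_branching_graph)
  then interpret full_branching_graph E \<omega> F .
  have single: "\<forall>\<alpha>\<in>arcs E. \<alpha> \<notin> B \<union> {\<delta>} \<longrightarrow> tail E \<alpha> \<in> weight_forest E \<omega> \<longrightarrow>
      out_arcs E (tail E \<alpha>) = {\<alpha>}"
    by (simp add: B_def)
  have "out_arcs E (tail E \<delta>) = {\<delta>}" using \<delta>(1,2) by (simp add: B_def)
  from path_word_through[OF \<delta>(1) \<open>tail E \<delta> \<in> reach (B \<union> {\<delta>})\<close> this single]
  obtain w where w: "set w \<subseteq> {Edge (\<alpha>, 1) | \<alpha>. \<alpha> \<in> arcs E \<and> \<alpha> \<notin> B \<union> {\<delta>}}"
    "infinite (hits E F (w @ [Edge (\<delta>, 1)]) (head E \<delta>))"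
    "infinite (- hits E F (w @ [Edge (\<delta>, 1)]) (head E \<delta>))"
    by (elim exE conjE) (rule that)
  have dom: "hits E F (rev (map star [Edge (\<beta>, 1)])) (head E \<delta>) = Domain (F \<beta> 1)"
    by (auto simp: hits_def \<delta>(4))
  show False
  proof (rule no_free_junction[OF branching \<delta>(1), of w "[Edge (\<beta>, 1)]"])
    show "infinite (hits E F (rev (map star [Edge (\<beta>, 1)])) (head E \<delta>))"
      unfolding dom using full[OF \<beta>'(1), of 1] weight_pos[OF \<beta>'(1)] by simp
    \<comment> \<open>The sibling occupies another cell of row 1, so its infinite domain lies in the
      complement.\<close>
    have "Domain (F \<beta>2 1) \<subseteq> - Domain (F \<beta> 1)"
      using row_unique[OF \<beta>2(1) \<beta>'(1) \<beta>2(2), of 1] \<beta>2(3) weight_pos[OF \<beta>'(1)] weight_pos[OF \<beta>2(1)] by fastforce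
    moreover have "infinite (Domain (F \<beta>2 1))" using full[OF \<beta>2(1), of 1] weight_pos[OF \<beta>2(1)] by simp
    ultimately show "infinite (- hits E F (rev (map star [Edge (\<beta>, 1)])) (head E \<delta>))"
      unfolding dom by (rule infinite_super)
    show "w \<in> lists (letters E \<omega>)" using w(1) by (rule word_in_letters)
    show "[Edge (\<beta>, 1)] \<in> lists (letters E \<omega>)" using edge_letter[OF \<beta>'(1)] by simp
  qed (use w \<beta>' in auto)
qed

text \<open>Of the two edges let \<open>p\<close> be one whose source is reached without either, and
  \<open>q\<close> the other. The path through \<open>q\<close> is followed by the adjoint of the
  path through \<open>p\<close>, and the junction is at \<open>q\<close>. Neither the part before
  \<open>q\<close> nor the path through \<open>p\<close> contains \<open>q\<close>.\<close>

lemma in_arcs_forest: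
  assumes \<gamma>: "\<gamma> \<in> arcs E" "tail E \<gamma> \<in> weight_forest E \<omega>"
    and \<delta>: "\<delta> \<in> arcs E" "tail E \<delta> \<in> weight_forest E \<omega>"
    and eq: "head E \<gamma> = head E \<delta>"
  shows "\<gamma> = \<delta>"
proof (rule ccontr)
  assume "\<gamma> \<noteq> \<delta>"
  obtain F where "full_branching_graph E \<omega> F"
    using row_finite by (rule ex_full_branching_graph)
  then interpret full_branching_graph E \<omega> F .
  have single: "\<forall>\<alpha>\<in>arcs E. \<alpha> \<notin> B \<longrightarrow> tail E \<alpha> \<in> weight_forest E \<omega> \<longrightarrow>
      out_arcs E (tail E \<alpha>) = {\<alpha>}" for B
    using out_arcs_forest by blast
  have False if p: "p \<in> arcs E" "tail E p \<in> reach {\<gamma>, \<delta>}" and q: "q \<in> arcs E" "tail E q \<in> weight_forest E \<omega>"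
    and pq: "p \<noteq> q" "q \<in> {\<gamma>, \<delta>}" "head E p = head E q" for p q
  proof -
    have "tail E q \<in> reach {q}" using forest_subset_reach[of "{q}"] q(2) by auto
    from path_word_through[OF q(1) this out_arcs_forest[OF q] single]
    obtain w where w: "set w \<subseteq> {Edge (\<alpha>, 1) | \<alpha>. \<alpha> \<in> arcs E \<and> \<alpha> \<notin> {q}}"
      "infinite (hits E F (w @ [Edge (q, 1)]) (head E q))"
      "infinite (- hits E F (w @ [Edge (q, 1)]) (head E q))"
      by (elim exE conjE) (rule that)
    have "tail E p \<in> weight_forest E \<omega>" using p(2) reach_subset_forest by auto
    from path_word_through[OF p(1,2) out_arcs_forest[OF p(1) this] single]
    obtain u where u: "set u \<subseteq> {Edge (\<alpha>, 1) | \<alpha>. \<alpha> \<in> arcs E \<and> \<alpha> \<notin> {\<gamma>, \<delta>}}"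
      "infinite (hits E F (u @ [Edge (p, 1)]) (head E p))"
      "infinite (- hits E F (u @ [Edge (p, 1)]) (head E p))"
      by (elim exE conjE) (rule that)
    let ?u = "u @ [Edge (p, 1)]"
    \<comment> \<open>\<open>no_free_junction\<close> measures its second word by the adjoint, and
      that word is itself an adjoint here.\<close>
    have star: "rev (map star (rev (map star ?u))) = ?u"
    proof -
      have "star (star x) = x" for x :: "('a, 'b) letter" by (cases x) auto
      then show ?thesis by (simp add: rev_map comp_def)
    qed
    show False
    proof (rule no_free_junction[OF branching q(1), of w "rev (map star ?u)"])
      show "w \<in> lists (letters E \<omega>)" using w(1) by (rule word_in_letters)
      have "star x \<in> letters E \<omega>" if "x \<in> letters E \<omega>" for x using that by (auto simp: letters_def)
      moreover have "?u \<in> lists (letters E \<omega>)" using word_in_letters[OF u(1)] edge_letter[OF p(1)] by auto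
      ultimately show "rev (map star ?u) \<in> lists (letters E \<omega>)"
        unfolding lists_eq_set mem_Collect_eq set_rev set_map by blast
      show "Edge (q, i) \<notin> set (w @ rev (map star ?u))" for i using w(1) u(1) by auto
      show "Ghost (q, i) \<notin> set (w @ rev (map star ?u))" for i using w(1) u(1) pq(1,2) by auto
    qed (use w u in \<open>auto simp only: star pq(3)\<close>)
  qed
  note contradiction = this
  \<comment> \<open>If neither source were reached, \<open>reach {\<gamma>, \<delta>}\<close> would
    contain the whole forest and thus both sources.\<close>
  have "tail E \<gamma> \<in> reach {\<gamma>, \<delta>} \<or> tail E \<delta> \<in> reach {\<gamma>, \<delta>}"
    using forest_subset_reach[of "{\<gamma>, \<delta>}"] \<gamma>(2) by auto
  then show False
    using contradiction[of \<gamma> \<delta>] contradiction[of \<delta> \<gamma>] \<gamma> \<delta> eq \<open>\<gamma> \<noteq> \<delta>\<close> by auto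
qed

lemma reducible: "reducible E \<omega>"
proof -
  have card: "finite A \<and> card A \<le> 1" if "\<And>a b. a \<in> A \<Longrightarrow> b \<in> A \<Longrightarrow> a = b" for A :: "'b set"
  proof (cases "A = {}")
    case False
    then obtain a where "a \<in> A" by blast
    then have "A = {a}" using that by blast
    then show ?thesis by simp
  qed simp
  show ?thesis
    unfolding reducible_def Let_def
  proof (intro ballI conjI)
    fix v assume v: "v \<in> weight_forest E \<omega>"
    have "\<alpha> = \<beta>" if "\<alpha> \<in> out_arcs E v" "\<beta> \<in> out_arcs E v" for \<alpha> \<beta>
    proof -
      have "out_arcs E v = {\<alpha>}" using out_arcs_forest[of \<alpha>] that(1) v by auto
      then show ?thesis using that(2) by simp
    qed
    then have "finite (out_arcs E v) \<and> card (out_arcs E v) \<le> 1" by (rule card)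
    then show "finite (out_arcs E v)" "card (out_arcs E v) \<le> 1" by (rule conjunct1, rule conjunct2)
    let ?B = "in_arcs E v \<inter> {\<alpha> \<in> arcs E. tail E \<alpha> \<in> weight_forest E \<omega>}"
    have "\<alpha> = \<beta>" if "\<alpha> \<in> ?B" "\<beta> \<in> ?B" for \<alpha> \<beta>
      using that by (intro in_arcs_forest) auto
    then have "finite ?B \<and> card ?B \<le> 1" by (rule card)
    then show "finite ?B" "card ?B \<le> 1" by (rule conjunct1, rule conjunct2)
  qed
qed

end

theorem theorem34:
  fixes E :: "('v, 'e) pre_digraph" and \<omega> :: "'e \<Rightarrow> nat"
  assumes "weighted_graph E \<omega>"
    and "row_finite E"
    and "weighted_vertices E \<omega> \<noteq> {}"
  shows "simple_rng (weighted_lpa TYPE('r::{ring, monoid_mult}) E \<omega>) \<longleftrightarrow>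
         reducible E \<omega> \<and> simple_rng (lpa TYPE('r) (associated_graph E \<omega>))"
proof -
  interpret weighted_graph E \<omega> by fact
  \<comment> \<open>Its action is what shows that the annihilators are proper ideals.\<close>
  obtain v where "v \<in> verts E" using assms(3) by (auto simp: weighted_vertices_def)
  then have "reducible E \<omega>" if "simple_rng (weighted_lpa TYPE('r) E \<omega>)"
    using word_rel_empty_transfer[OF that assms(2)] assms(2)
    by (intro rigid_graph.reducible rigid_graph.intro rigid_graph_axioms.intro weighted_graph_axioms) blast+
  moreover have "simple_rng (weighted_lpa TYPE('r) E \<omega>) \<longleftrightarrow> simple_rng (lpa TYPE('r) (associated_graph E \<omega>))"
    if "reducible E \<omega>"
  proof -
    interpret reducible_graph E \<omega> using assms(2) that by unfold_locales
    show ?thesis by (rule simple_iff_associated)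
  qed
  ultimately show ?thesis by blast
qed

end
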